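(* Let $\mathbb{H}^N$ be the Heisenberg group with homogeneous dimension $Q=2N+2$, let $\lambda\in\big(0,\big(\tfrac{Q-2}{2}\big)^2\big)$, $\gamma\in[0,1)$ and $\alpha\in(-1,0)$. Assume that $$\int_{\mathbb{H}^N}\|\xi\|_H^{-\mu(\lambda)}u_0(\xi)\,d\xi<\infty,\qquad 0<\int_{\mathbb{H}^N}\|\xi\|_H^{-\mu(\lambda)}f(\xi)\,d\xi<\infty .$$ Then, for any $$1<p<\frac{Q+2\gamma-\mu(\lambda)-2\alpha}{Q-2-\mu(\lambda)-2\alpha},$$ the problem $$\partial_tu-\Delta_{H}u=\lambda \frac{\psi u}{\|\cdot\|_{H}^{2}}+\frac{1}{\Gamma(\gamma)}\int_0^t(t-\tau)^{\gamma-1}|u(\tau)|^{p}\,d\tau+t^\alpha f \ \text{ in } \mathbb{H}^N\times(0,T),\qquad u(\cdot,0)=u_0 \ \text{ in } \mathbb{H}^N,$$ does not admit a global-in-time weak solution.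
   Context: **Heisenberg group.** $\mathbb{H}^N$ is $\mathbb{R}^{2N+1}$ with points $\xi=(x,y,w)$, $x,y\in\mathbb{R}^N$, $w\in\mathbb{R}$, and group law $(x,y,w)\circ(x',y',w')=(x+x',y+y',w+w'+2\langle y,x'\rangle-2\langle x,y'\rangle)$. $Q=2N+2$. $d\xi$ is Lebesgue measure on $\mathbb{R}^{2N+1}$. Let $X_i=\partial_{x_i}+2y_i\partial_w$, $Y_i=\partial_{y_i}-2x_i\partial_w$ ($1\le i\le N$); $\nabla_H u=(X_1u,\dots,X_Nu,Y_1u,\dots,Y_Nu)$; $\Delta_H=\sum_{i=1}^N(X_i^2+Y_i^2)$; $\nabla_H\cdot$ denotes the corresponding horizontal divergence. The Korányi norm is $\|\xi\|_H=\big[\big(\sum_{i=1}^N(x_i^2+y_i^2)\big)^2+w^2\big]^{1/4}$, and $\psi=\big|\nabla_H\|\cdot\|_H\big|^2$. **Constant $\mu(\lambda)$.** For $\lambda\in(0,(\frac{Q-2}{2})^2)$, $\mu(\lambda)=\frac{Q-2}{2}-\sqrt{\big(\frac{Q-2}{2}\big)^2-\lambda}$. **Memory term.** For $\gamma\in(0,1)$, $I_{T^-}^\gamma\phi(t)=\frac{1}{\Gamma(\gamma)}\int_t^T(\tau-t)^{\gamma-1}\phi(\tau)\,d\tau$, and $I^0_{T^-}\phi=\phi$. Correspondingly, for $\gamma=0$ the term $\frac{1}{\Gamma(\gamma)}\int_0^t(t-\tau)^{\gamma-1}|u(\tau)|^p\,d\tau$ means $|u(t)|^p$. **Weak solution.**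 Put $v(\xi,t)=\|\xi\|_H^{\mu(\lambda)}u(\xi,t)$, $v(0,\xi)=\|\xi\|_H^{\mu(\lambda)}u_0(\xi)$, and $L_H\phi=-\nabla_H\cdot\big(\|\cdot\|_H^{-2\mu(\lambda)}\nabla_H\phi\big)$. Let $v(0,\cdot)\in L^1_{\rm loc}(\mathbb{H}^N,\|\xi\|_H^{-2\mu(\lambda)}d\xi)$ and $f\in L^1_{\rm loc}(\mathbb{H}^N,\|\xi\|_H^{-\mu(\lambda)}d\xi)$. The function $v\in L^p_{\rm loc}((0,T),L^p_{\rm loc}(\mathbb{H}^N,\|\xi\|_H^{-(p+1)\mu(\lambda)}d\xi))\cap L^1_{\rm loc}((0,T),L^1_{\rm loc}(\mathbb{H}^N,\|\xi\|_H^{-2\mu(\lambda)}d\xi))$ (equivalently $u$) is a local-in-time weak solution of the problem on $(0,T)$ if $$-\int_0^T\!\!\int_{\mathbb{H}^N}v\big(\|\xi\|_H^{-2\mu(\lambda)}\partial_t\phi-L_H\phi\big)d\xi dt=\int_0^T\!\!\int_{\mathbb{H}^N}\|\xi\|_H^{-(p+1)\mu(\lambda)}|v|^pI^\gamma_{T^-}\phi\,d\xi dt+\int_{\mathbb{H}^N}\|\xi\|_H^{-2\mu(\lambda)}v(0,\xi)\phi(0,\xi)d\xi+\int_0^T\!\!\int_{\mathbb{H}^N}\|\xi\|_H^{-\mu(\lambda)}t^\alpha f\phi\,d\xi dt$$ for every non-negative test function $\phi\in C_c^1([0,T),C_c^2(\mathbb{H}^N))$. It is a global-in-time weak solution if $T=\infty$.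 The integral conditions on $u_0$ and $f$ are understood as saying that these integrals exist as finite real numbers. *)

theory Defs
  imports "HOL-Analysis.Analysis"
begin

text \<open>Points \<open>(x, y, w)\<close> of the Heisenberg group with \<open>N = CARD('n)\<close>; Lebesgue measure on
  $R^{2N+1}$ is the library's \<^const>\<open>lebesgue\<close> on this product Euclidean space.\<close>

type_synonym 'n heis = "(real ^ 'n) \<times> (real ^ 'n) \<times> real"

definition hom_dim :: "'n::finite itself \<Rightarrow> real" where
  "hom_dim _ = 2 * real CARD('n) + 2"

definition koranyi :: "'n::finite heis \<Rightarrow> real" where
  "koranyi = (\<lambda>(x, y, w). ((\<Sum>i\<in>UNIV. (x $ i)\<^sup>2 + (y $ i)\<^sup>2)\<^sup>2 + w\<^sup>2) powr (1 / 4))"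

definition hardy_mu :: "'n::finite itself \<Rightarrow> real \<Rightarrow> real" where
  "hardy_mu N lam =
     (hom_dim N - 2) / 2 - sqrt (((hom_dim N - 2) / 2)\<^sup>2 - lam)"

definition pderiv_dir :: "'a::euclidean_space \<Rightarrow> ('a \<Rightarrow> real) \<Rightarrow> 'a \<Rightarrow> real" where
  "pderiv_dir e g z = deriv (\<lambda>s. g (z + s *\<^sub>R e)) 0"

definition X_field :: "'n::finite \<Rightarrow> ('n heis \<Rightarrow> real) \<Rightarrow> 'n heis \<Rightarrow> real" where
  "X_field i g = (\<lambda>(x, y, w).
     pderiv_dir (axis i 1, 0, 0) g (x, y, w) + 2 * (y $ i) * pderiv_dir (0, 0, 1) g (x, y, w))"

definition Y_field :: "'n::finite \<Rightarrow> ('n heis \<Rightarrow> real) \<Rightarrow> 'n heis \<Rightarrow> real" where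
  "Y_field i g = (\<lambda>(x, y, w).
     pderiv_dir (0, axis i 1, 0) g (x, y, w) - 2 * (x $ i) * pderiv_dir (0, 0, 1) g (x, y, w))"

definition hgrad :: "('n::finite heis \<Rightarrow> real) \<Rightarrow> 'n heis \<Rightarrow> (real ^ 'n) \<times> (real ^ 'n)" where
  "hgrad g z = (\<chi> i. X_field i g z, \<chi> i. Y_field i g z)"

definition hdiv :: "('n::finite heis \<Rightarrow> (real ^ 'n) \<times> (real ^ 'n)) \<Rightarrow> 'n heis \<Rightarrow> real" where
  "hdiv F z = (\<Sum>i\<in>UNIV. X_field i (\<lambda>z'. fst (F z') $ i) z + Y_field i (\<lambda>z'. snd (F z') $ i) z)"

text \<open>At the origin the weight is singular and the value of \<open>L_H\<close> there is meaningless; it is only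
  used under integrals.\<close>

definition L_H :: "real \<Rightarrow> ('n::finite heis \<Rightarrow> real) \<Rightarrow> 'n heis \<Rightarrow> real" where
  "L_H m g z = - hdiv (\<lambda>z'. (koranyi z' powr (- 2 * m)) *\<^sub>R hgrad g z') z"

definition C1_fun :: "('a::euclidean_space \<Rightarrow> real) \<Rightarrow> bool" where
  "C1_fun g \<longleftrightarrow> continuous_on UNIV g \<and>
     (\<forall>e\<in>Basis. (\<forall>z. (\<lambda>s. g (z + s *\<^sub>R e)) field_differentiable (at 0)) \<and>
                continuous_on UNIV (pderiv_dir e g))"

definition C2_fun :: "('a::euclidean_space \<Rightarrow> real) \<Rightarrow> bool" where
  "C2_fun g \<longleftrightarrow> C1_fun g \<and> (\<forall>e\<in>Basis. C1_fun (pderiv_dir e g))"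

text \<open>Convergence in the space of \<open>C\<^sup>2\<close> functions supported in a fixed compact set: uniform
  convergence of all derivatives of order at most two.\<close>

definition C2_tendsto ::
    "('b \<Rightarrow> 'a::euclidean_space \<Rightarrow> real) \<Rightarrow> ('a \<Rightarrow> real) \<Rightarrow> 'b filter \<Rightarrow> bool" where
  "C2_tendsto h g F \<longleftrightarrow>
     uniform_limit UNIV h g F \<and>
     (\<forall>e\<in>Basis. uniform_limit UNIV (\<lambda>s. pderiv_dir e (h s)) (pderiv_dir e g) F) \<and>
     (\<forall>d\<in>Basis. \<forall>e\<in>Basis.
        uniform_limit UNIV (\<lambda>s. pderiv_dir d (pderiv_dir e (h s))) (pderiv_dir d (pderiv_dir e g)) F)"

text \<open>The class \<open>C\<^sub>c\<^sup>1([0,T), C\<^sub>c\<^sup>2)\<close>. Since the time support is compact, the spatial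
  supports lie in one compact set \<open>K\<close> (a compact subset of the inductive limit \<open>C\<^sub>c\<^sup>2\<close> is
  contained in one of its steps). Time derivatives are derivatives of the \<open>C\<^sup>2\<close>-valued curve,
  one-sided at \<open>t = 0\<close>. The values \<open>\<phi> t\<close> for \<open>t\<close> outside \<open>[0,T)\<close> play no role.\<close>

definition test_function :: "ereal \<Rightarrow> (real \<Rightarrow> 'a::euclidean_space \<Rightarrow> real) \<Rightarrow> bool" where
  "test_function T \<phi> \<longleftrightarrow> (let I = {t. 0 \<le> t \<and> ereal t < T} in
     (\<exists>J K. compact J \<and> J \<subseteq> I \<and> compact K \<and>
        (\<forall>t\<in>I. \<forall>z. \<phi> t z \<noteq> 0 \<longrightarrow> t \<in> J \<and> z \<in> K)) \<and>
     (\<exists>\<phi>'. \<forall>t\<in>I. C2_fun (\<phi> t) \<and> C2_fun (\<phi>' t) \<and>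
        C2_tendsto (\<lambda>s z. (\<phi> s z - \<phi> t z) / (s - t)) (\<phi>' t) (at t within I) \<and>
        C2_tendsto \<phi>' (\<phi>' t) (at t within I)))"

definition frac_int :: "real \<Rightarrow> ereal \<Rightarrow> (real \<Rightarrow> real) \<Rightarrow> real \<Rightarrow> real" where
  "frac_int gam T h t =
     (if gam = 0 then h t
      else 1 / Gamma gam * (LBINT \<tau>=ereal t..T. (\<tau> - t) powr (gam - 1) * h \<tau>))"

text \<open>Lebesgue integrability and integral over \<open>(0,T) \<times> H\<^sup>N\<close>.\<close>

definition st_integrable :: "ereal \<Rightarrow> (real \<Rightarrow> 'a::euclidean_space \<Rightarrow> real) \<Rightarrow> bool" where
  "st_integrable T F \<longleftrightarrow> set_integrable lebesgue (einterval 0 T \<times> UNIV) (\<lambda>(t, z). F t z)"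

definition st_integral :: "ereal \<Rightarrow> (real \<Rightarrow> 'a::euclidean_space \<Rightarrow> real) \<Rightarrow> real" where
  "st_integral T F = set_lebesgue_integral lebesgue (einterval 0 T \<times> UNIV) (\<lambda>(t, z). F t z)"

text \<open>\<open>L\<^sup>1_loc(\<rho> dz)\<close>, and \<open>L\<^sup>p_loc((0,T), L\<^sup>p_loc(\<rho> dz))\<close> as a space of functions of \<open>(t, z)\<close>; the
  weight \<open>\<rho>\<close> is positive almost everywhere.\<close>

definition L1_loc :: "('a::euclidean_space \<Rightarrow> real) \<Rightarrow> ('a \<Rightarrow> real) \<Rightarrow> bool" where
  "L1_loc \<rho> g \<longleftrightarrow> g \<in> borel_measurable lebesgue \<and>
     (\<forall>K. compact K \<longrightarrow> set_integrable lebesgue K (\<lambda>z. \<rho> z * g z))"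

definition Lp_loc_st ::
    "real \<Rightarrow> ereal \<Rightarrow> ('a::euclidean_space \<Rightarrow> real) \<Rightarrow> (real \<Rightarrow> 'a \<Rightarrow> real) \<Rightarrow> bool" where
  "Lp_loc_st p T \<rho> v \<longleftrightarrow>
     set_borel_measurable lebesgue (einterval 0 T \<times> UNIV) (\<lambda>(t, z). v t z) \<and>
     (\<forall>J K. compact J \<and> J \<subseteq> einterval 0 T \<and> compact K \<longrightarrow>
        set_integrable lebesgue (J \<times> K) (\<lambda>(t, z). \<rho> z * \<bar>v t z\<bar> powr p))"

text \<open>Weak solutions \<open>u\<close> on \<open>(0,T)\<close> of
  \[ u_t - \Delta_H u = \lambda \psi u / |z|_H^2
       + \Gamma(\gamma)^{-1} \int_0^t (t-\tau)^{\gamma-1} |u(\tau)|^p d\tau + t^\alpha f,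
     \quad u(0) = u_0, \]
  in terms of \<open>v = |z|\<^sub>H\<^sup>\<mu> u\<close>. The Hardy term is absorbed by this substitution, because
  \<open>|z|\<^sub>H\<close> to the power \<open>- \<mu>\<close> is annihilated by \<open>-\<Delta>\<^sub>H - \<lambda> \<psi> / |z|\<^sub>H\<^sup>2\<close> away from the origin.
  The local regularity of \<open>v\<close> is on the open interval \<open>(0,T)\<close>, and \<open>L_H \<phi>\<close> is singular
  at the origin, so it does not make the integrals in the identity finite; that they exist is part
  of the identity (the library's integral of a non-integrable function is \<open>0\<close>).\<close>

definition weak_solution ::
    "real \<Rightarrow> real \<Rightarrow> real \<Rightarrow> real \<Rightarrow> ('n::finite heis \<Rightarrow> real) \<Rightarrow> ('n heis \<Rightarrow> real) \<Rightarrow>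
     ereal \<Rightarrow> (real \<Rightarrow> 'n heis \<Rightarrow> real) \<Rightarrow> bool" where
  "weak_solution lam gam \<alpha> p f u0 T u \<longleftrightarrow>
    (let m = hardy_mu TYPE('n) lam;
         v = (\<lambda>t z. koranyi z powr m * u t z);
         v0 = (\<lambda>z. koranyi z powr m * u0 z)
     in
       L1_loc (\<lambda>z. koranyi z powr (- 2 * m)) v0 \<and>
       L1_loc (\<lambda>z. koranyi z powr (- m)) f \<and>
       Lp_loc_st p T (\<lambda>z. koranyi z powr (- (p + 1) * m)) v \<and>
       Lp_loc_st 1 T (\<lambda>z. koranyi z powr (- 2 * m)) v \<and>
       (\<forall>\<phi>. test_function T \<phi> \<and> (\<forall>t z. 0 \<le> t \<and> ereal t < T \<longrightarrow> 0 \<le> \<phi> t z) \<longrightarrow>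
         (let A = (\<lambda>t z. v t z * (koranyi z powr (- 2 * m) * deriv (\<lambda>s. \<phi> s z) t - L_H m (\<phi> t) z));
              B = (\<lambda>t z. koranyi z powr (- (p + 1) * m) * \<bar>v t z\<bar> powr p
                           * frac_int gam T (\<lambda>s. \<phi> s z) t);
              C = (\<lambda>z. koranyi z powr (- 2 * m) * v0 z * \<phi> 0 z);
              D = (\<lambda>t z. koranyi z powr (- m) * t powr \<alpha> * f z * \<phi> t z)
          in st_integrable T A \<and> st_integrable T B \<and> integrable lebesgue C \<and> st_integrable T D \<and>
             - st_integral T A = st_integral T B + integral\<^sup>L lebesgue C + st_integral T D)))"

definition global_weak_solution ::
    "real \<Rightarrow> real \<Rightarrow> real \<Rightarrow> real \<Rightarrow> ('n::finite heis \<Rightarrow> real) \<Rightarrow> ('n heis \<Rightarrow> real) \<Rightarrow>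
     (real \<Rightarrow> 'n heis \<Rightarrow> real) \<Rightarrow> bool" where
  "global_weak_solution lam gam \<alpha> p f u0 u \<longleftrightarrow> weak_solution lam gam \<alpha> p f u0 \<infinity> u"

end

theory Submission
  imports Defs
begin

text \<open>The proof is by nonlinear capacity. Test the weak identity with
  \<open>\<phi>(t, z) = a(t) b(z)\<close>, where \<open>a(t) = (1 - t/T)\<^sub>+^n\<close> and \<open>b(z) = h(|z|^4 / R^4)\<close> for a cut-off \<open>h\<close>
  that is \<open>1\<close> on \<open>(-\<infinity>, 1]\<close> and \<open>0\<close> on \<open>[2, \<infinity>)\<close>, with the parabolic scaling \<open>T = R\<^sup>2\<close>. Here
  \<open>|z|\<close> is the Koranyi norm. Since \<open>b\<close> is constant near the origin, the singular weight in \<open>L_H\<close> is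
  never differentiated there, and since \<open>b\<close> is radial, \<open>L_H b\<close> has a closed form, which gives
  \<open>|L_H b| \<le> C R\<^sup>-\<^sup>2 |z|^(-2m) b^(1/p)\<close>. The power \<open>b^(1/p)\<close> comes from choosing \<open>h\<close> to vanish to a high
  order at \<open>2\<close>.

  The memory operator satisfies \<open>I^\<gamma> a \<ge> c T^\<gamma> (1 - t/T)\<^sub>+^(n + \<gamma>)\<close>. If \<open>n\<close> is large, Young's
  inequality therefore absorbs the linear terms \<open>|v| |z|^(-2m) |\<partial>\<^sub>t\<phi>|\<close> and \<open>|v| |L_H \<phi>|\<close> into
  the nonlinear term \<open>|z|^(-(p+1)m) |v|^p I^\<gamma> \<phi>\<close>, pointwise, at the price of a remainder
  \<open>const R^(-2(p + \<gamma>)/(p-1)) |z|^(-m)\<close> on the support of \<open>\<phi>\<close>. As the integral of \<open>|z|^(-m)\<close> over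
  a ball of radius \<open>\<rho>\<close> is at most \<open>const \<rho>^(Q-m)\<close>, what remains of the identity is
  \[ R^{2(1+\alpha)} \int |z|^{-m} f b \le C \int |z|^{-m} |u_0| + C R^{Q + 2 - m - 2(p+\gamma)/(p-1)} . \]
  The integral on the left tends to \<open>\<integral> |z|^(-m) f > 0\<close> as \<open>R \<rightarrow> \<infinity>\<close>. The upper bound on \<open>p\<close> says exactly
  that the exponent on the right is smaller than \<open>2(1 + \<alpha>)\<close>, and \<open>2(1 + \<alpha>) > 0\<close>, so the inequality fails
  for large \<open>R\<close>.

  The pointwise estimates are assembled in \<open>testing_estimate\<close>; its main ingredients are
  \<open>L_H_cutoff_bound\<close>, \<open>frac_int_pos_pow_ge\<close>, \<open>young_weighted\<close> and \<open>nn_integral_koranyi4_weight_le\<close>.\<close>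


section \<open>Truncated powers and a smooth cut-off\<close>

definition pos_pow :: "nat \<Rightarrow> real \<Rightarrow> real" where
  "pos_pow k x = max 0 x ^ k"

lemma pos_pow_nonneg [simp]: "0 \<le> pos_pow k x"
  by (simp add: pos_pow_def)

lemma pos_pow_le_one: "x \<le> 1 \<Longrightarrow> pos_pow k x \<le> 1"
  by (simp add: pos_pow_def power_le_one)

lemma continuous_on_pos_pow [continuous_intros]:
  "continuous_on S g \<Longrightarrow> continuous_on S (\<lambda>x. pos_pow k (g x))"
  unfolding pos_pow_def by (intro continuous_intros)

lemma pos_pow_eq_0: "x \<le> 0 \<Longrightarrow> 0 < k \<Longrightarrow> pos_pow k x = 0"
  by (simp add: pos_pow_def)

lemma DERIV_pos_pow:
  assumes "2 \<le> k"
  shows "(pos_pow k has_real_derivative real k * pos_pow (k - 1) x) (at x)"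
proof -
  obtain j where k: "k = Suc (Suc j)"
    using le_Suc_ex[OF assms] by auto
  consider "x > 0" | "x < 0" | "x = 0" by linarith
  then show ?thesis
  proof cases
    case 1
    have "((\<lambda>y. y ^ k) has_real_derivative real k * pos_pow (k - 1) x) (at x)"
      using 1 by (auto simp: pos_pow_def intro!: derivative_eq_intros)
    then show ?thesis
      by (rule has_field_derivative_transform_within_open[where S = "{0<..}"])
         (use 1 in \<open>auto simp: pos_pow_def\<close>)
  next
    case 2
    have "((\<lambda>y. 0) has_real_derivative real k * pos_pow (k - 1) x) (at x)"
      using 2 k by (simp add: pos_pow_eq_0)
    then show ?thesis
      by (rule has_field_derivative_transform_within_open[where S = "{..<0}"])
         (use 2 k in \<open>auto simp: pos_pow_eq_0\<close>)
  next
    case 3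
    \<comment> \<open>At the kink, the difference quotient is itself a truncated power, hence continuous.\<close>
    have "isCont (\<lambda>z. max 0 z ^ Suc j) (0::real)"
      by (intro continuous_intros)
    then show ?thesis
      unfolding CARAT_DERIV pos_pow_def using 3 k
      by (intro exI[of _ "\<lambda>z. max 0 z ^ Suc j"]) (auto simp: max_def)
  qed
qed

lemma DERIV_pos_pow_compose [derivative_intros]:
  assumes "2 \<le> k" "(g has_real_derivative d) (at x)"
  shows "((\<lambda>x. pos_pow k (g x)) has_real_derivative real k * pos_pow (k - 1) (g x) * d) (at x)"
  using DERIV_chain2[OF DERIV_pos_pow[OF assms(1)] assms(2)] .

text \<open>The bounds of \<open>h'\<close> and \<open>h''\<close> by \<open>h^(1/p)\<close> are what lets Young's inequality absorb the terms
  with derivatives of the cut-off. They hold for \<open>h = (1 - (s - 1)\<^sub>+\<^sup>3)\<^sub>+^n\<close>: two derivatives cost two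
  powers of the base, and \<open>n - 2 \<ge> n/p\<close> for large \<open>n\<close>. The inner cube makes the function \<open>C\<^sup>2\<close> at \<open>s = 1\<close>,
  the outer power makes it \<open>C\<^sup>2\<close> at \<open>s = 2\<close>.\<close>

lemma ex_smooth_cutoff:
  fixes p :: real
  assumes p: "1 < p"
  shows "\<exists>h h' h'' C. 0 < C \<and>
    (\<forall>s. (h has_real_derivative h' s) (at s)) \<and> (\<forall>s. (h' has_real_derivative h'' s) (at s)) \<and>
    continuous_on UNIV h'' \<and>
    (\<forall>s. 0 \<le> h s \<and> h s \<le> 1) \<and>
    (\<forall>s\<le>1. h s = 1 \<and> h' s = 0) \<and> (\<forall>s\<ge>2. h s = 0) \<and>
    (\<forall>s. \<bar>h' s\<bar> \<le> C * h s powr (1 / p)) \<and> (\<forall>s. \<bar>h'' s\<bar> \<le> C * h s powr (1 / p))"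
proof -
  obtain n0 :: nat where "2 / (1 - 1 / p) < real n0"
    using reals_Archimedean2 by blast
  define n where "n = n0 + 4"
  have n4: "4 \<le> n" by (simp add: n_def)
  have "2 / (1 - 1 / p) \<le> real n"
    using \<open>2 / (1 - 1 / p) < real n0\<close> by (simp add: n_def)
  then have np: "real n / p \<le> real n - 2"
    using p by (simp add: field_simps)
  define u where "u = (\<lambda>s::real. 1 - pos_pow 3 (s - 1))"
  define u' where "u' = (\<lambda>s::real. - (3 * pos_pow 2 (s - 1)))"
  define u'' where "u'' = (\<lambda>s::real. - (6 * pos_pow 1 (s - 1)))"
  define h where "h = (\<lambda>s. pos_pow n (u s))"
  define h' where "h' = (\<lambda>s. real n * pos_pow (n - 1) (u s) * u' s)"
  define h'' where "h'' = (\<lambda>s. real n * (real (n - 1) * pos_pow (n - 2) (u s) * u' s * u' s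
                                 + pos_pow (n - 1) (u s) * u'' s))"
  define C where "C = real n * (real n * 9 + 6)"
  have du: "(u has_real_derivative u' s) (at s)" for s
    unfolding u_def u'_def by (auto intro!: derivative_eq_intros)
  have du': "(u' has_real_derivative u'' s) (at s)" for s
    unfolding u'_def u''_def by (auto intro!: derivative_eq_intros)
  have dh: "(h has_real_derivative h' s) (at s)" for s
    unfolding h_def h'_def using n4 by (auto intro!: derivative_eq_intros du)
  have dh': "(h' has_real_derivative h'' s) (at s)" for s
    unfolding h'_def h''_def using n4
    by (auto intro!: derivative_eq_intros du du' simp: algebra_simps numeral_2_eq_2)
  have ch'': "continuous_on UNIV h''"
    unfolding h''_def u_def u'_def u''_def by (intro continuous_intros)
  have u1: "u s \<le> 1" for s by (simp add: u_def)
  have h01: "0 \<le> h s \<and> h s \<le> 1" for s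
    unfolding h_def using u1 by (auto intro: pos_pow_le_one)
  have hl: "h s = 1 \<and> h' s = 0" if "s \<le> 1" for s
    using that by (simp add: h_def h'_def u_def u'_def pos_pow_def)
  have hr: "h s = 0" if "s \<ge> 2" for s
  proof -
    have "1 \<le> (s - 1) ^ 3" using that by (intro one_le_power) auto
    then have "u s \<le> 0" using that by (simp add: u_def pos_pow_def)
    then show ?thesis using n4 by (simp add: h_def pos_pow_eq_0)
  qed
  have key: "\<bar>h' s\<bar> \<le> C * h s powr (1 / p) \<and> \<bar>h'' s\<bar> \<le> C * h s powr (1 / p)" for s
  proof (cases "u s > 0")
    case False
    then show ?thesis using n4
      by (simp add: h'_def h''_def pos_pow_eq_0 C_def)
  next
    case True
    have "(s - 1) \<le> 1"
    proof (rule ccontr)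
      assume "\<not> s - 1 \<le> 1"
      then have "1 \<le> (s - 1) ^ 3" by (intro one_le_power) auto
      moreover have "(s - 1) ^ 3 < 1"
        using True \<open>\<not> s - 1 \<le> 1\<close> by (simp add: u_def pos_pow_def)
      ultimately show False by linarith
    qed
    then have pp: "pos_pow k (s - 1) \<le> 1" for k
      by (rule pos_pow_le_one)
    then have bu': "\<bar>u' s\<bar> \<le> 3" and bu'': "\<bar>u'' s\<bar> \<le> 6"
      by (auto simp: u'_def u''_def)
    define e where "e = u s ^ (n - 2)"
    have e0: "0 \<le> e" using True by (simp add: e_def)
    have e1: "pos_pow (n - 1) (u s) \<le> e" "pos_pow (n - 2) (u s) = e" "0 \<le> pos_pow (n - 1) (u s)"
      using True u1[of s] n4 unfolding e_def pos_pow_def by (auto intro!: power_decreasing)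
    have "e = u s powr (real n - 2)"
      using True n4 by (simp add: e_def powr_realpow[symmetric])
    also have "\<dots> \<le> u s powr (real n / p)"
      using True u1 np by (intro powr_mono') auto
    also have "\<dots> = h s powr (1 / p)"
      using True by (simp add: h_def pos_pow_def powr_powr powr_realpow[symmetric])
    finally have eh: "e \<le> h s powr (1 / p)" .
    have "\<bar>h' s\<bar> = real n * (pos_pow (n - 1) (u s) * \<bar>u' s\<bar>)"
      by (simp add: h'_def abs_mult)
    also have "\<dots> \<le> real n * (e * 3)"
      using e1 bu' e0 by (intro mult_left_mono mult_mono) auto
    also have "\<dots> \<le> C * e"
      using e0 unfolding C_def by (simp add: algebra_simps mult_left_mono)
    finally have 1: "\<bar>h' s\<bar> \<le> C * e" .
    have "\<bar>h'' s\<bar> \<le> real n * (real (n - 1) * pos_pow (n - 2) (u s) * \<bar>u' s\<bar> * \<bar>u' s\<bar>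
                                 + pos_pow (n - 1) (u s) * \<bar>u'' s\<bar>)"
      unfolding h''_def abs_mult[of "real n"] abs_of_nat
      by (intro mult_left_mono order_trans[OF abs_triangle_ineq]) (auto simp: abs_mult)
    also have "\<dots> \<le> real n * (real n * e * 3 * 3 + e * 6)"
      using e1 bu' bu'' e0 by (intro mult_left_mono mult_mono add_mono) auto
    also have "\<dots> = C * e" by (simp add: C_def algebra_simps)
    finally have 2: "\<bar>h'' s\<bar> \<le> C * e" .
    have "C * e \<le> C * h s powr (1 / p)"
      using eh by (intro mult_left_mono) (auto simp: C_def)
    with 1 2 show ?thesis by linarith
  qed
  have C0: "0 < C" using n4 by (simp add: C_def)
  show ?thesis
    using dh dh' ch'' h01 hl hr key C0
    by (intro exI[of _ h] exI[of _ h'] exI[of _ h''] exI[of _ C]) simp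
qed

section \<open>Horizontal calculus of radial functions\<close>

text \<open>The inner product of the horizontal components; \<open>hinner z z\<close> is \<open>|x|\<^sup>2 + |y|\<^sup>2\<close>.\<close>

definition hinner :: "'n::finite heis \<Rightarrow> 'n heis \<Rightarrow> real" where
  "hinner z e = fst z \<bullet> fst e + fst (snd z) \<bullet> fst (snd e)"

text \<open>The fourth power of the Koranyi norm is a polynomial. All cut-offs below are functions of it, so that
  no differentiability question arises at the origin.\<close>

definition koranyi4 :: "'n::finite heis \<Rightarrow> real" where
  "koranyi4 z = (hinner z z)\<^sup>2 + (snd (snd z))\<^sup>2"

definition dkoranyi4 :: "'n::finite heis \<Rightarrow> 'n heis \<Rightarrow> real" where
  "dkoranyi4 e z = 4 * hinner z z * hinner z e + 2 * snd (snd z) * snd (snd e)"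

lemma hinner_nonneg [simp]: "0 \<le> hinner z z"
  by (simp add: hinner_def)

lemma koranyi4_nonneg [simp]: "0 \<le> koranyi4 z"
  by (simp add: koranyi4_def)

lemma hinner_self_sum: "hinner z z = (\<Sum>i\<in>UNIV. (fst z $ i)\<^sup>2 + (fst (snd z) $ i)\<^sup>2)"
  by (simp add: hinner_def inner_vec_def sum.distrib power2_eq_square)

lemma koranyi_eq_koranyi4: "koranyi z = koranyi4 z powr (1 / 4)"
  by (cases z) (simp add: koranyi_def koranyi4_def hinner_self_sum)

lemma koranyi_powr: "koranyi z powr a = koranyi4 z powr (a / 4)"
  by (simp add: koranyi_eq_koranyi4 powr_powr)

lemma hinner_le: "hinner z z \<le> sqrt (koranyi4 z)"
  by (rule real_le_rsqrt) (simp add: koranyi4_def)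

lemma continuous_on_hinner [continuous_intros]:
  "continuous_on S g \<Longrightarrow> continuous_on S k \<Longrightarrow> continuous_on S (\<lambda>z. hinner (g z) (k z))"
  unfolding hinner_def by (intro continuous_intros)

lemma continuous_on_koranyi4 [continuous_intros]:
  "continuous_on S g \<Longrightarrow> continuous_on S (\<lambda>z. koranyi4 (g z))"
  unfolding koranyi4_def by (intro continuous_intros)

lemma continuous_on_dkoranyi4 [continuous_intros]:
  "continuous_on S g \<Longrightarrow> continuous_on S (\<lambda>z. dkoranyi4 e (g z))"
  unfolding dkoranyi4_def by (intro continuous_intros)

lemma hinner_shift:
  "hinner (z + s *\<^sub>R d) e = hinner z e + s * hinner d e"
  "hinner e (z + s *\<^sub>R d) = hinner e z + s * hinner e d"
  by (simp_all add: hinner_def inner_add_left inner_add_right algebra_simps)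

lemma hinner_commute: "hinner z e = hinner e z"
  by (simp add: hinner_def inner_commute)

lemma dderiv_hinner_self:
  "((\<lambda>s. hinner (z + s *\<^sub>R e) (z + s *\<^sub>R e)) has_real_derivative 2 * hinner z e) (at 0)"
  unfolding hinner_shift
  by (auto intro!: derivative_eq_intros simp: hinner_commute[of e z])

lemma dderiv_koranyi4: "((\<lambda>s. koranyi4 (z + s *\<^sub>R e)) has_real_derivative dkoranyi4 e z) (at 0)"
  unfolding koranyi4_def dkoranyi4_def
  by (auto intro!: derivative_eq_intros dderiv_hinner_self)

lemma dderiv_dkoranyi4:
  "((\<lambda>s. dkoranyi4 e (z + s *\<^sub>R d)) has_real_derivative
     8 * hinner z d * hinner z e + 4 * hinner z z * hinner d e + 2 * snd (snd d) * snd (snd e)) (at 0)"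
  unfolding dkoranyi4_def hinner_shift(1)[of _ _ _ e]
  by (auto intro!: derivative_eq_intros dderiv_hinner_self)

lemma pderiv_dir_eqI:
  "((\<lambda>s. g (z + s *\<^sub>R e)) has_real_derivative D) (at 0) \<Longrightarrow> pderiv_dir e g z = D"
  unfolding pderiv_dir_def by (rule DERIV_imp_deriv)

lemma C1_funI:
  assumes "continuous_on UNIV g"
    and "\<And>e z. ((\<lambda>s. g (z + s *\<^sub>R e)) has_real_derivative D e z) (at 0)"
    and "\<And>e. continuous_on UNIV (D e)"
  shows "C1_fun g"
proof -
  have "pderiv_dir e g = D e" for e
    using assms(2) by (intro ext pderiv_dir_eqI)
  with assms show ?thesis
    unfolding C1_fun_def field_differentiable_def by auto
qed

lemma dderiv_radial:
  assumes "\<And>s. (H has_real_derivative H' s) (at s)"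
  shows "((\<lambda>s. H (koranyi4 (z + s *\<^sub>R e))) has_real_derivative H' (koranyi4 z) * dkoranyi4 e z) (at 0)"
  using DERIV_chain2[of H "H' (koranyi4 z)" "\<lambda>s. koranyi4 (z + s *\<^sub>R e)" 0] assms dderiv_koranyi4[of z e]
  by simp

lemma C2_fun_radial:
  fixes H H' H'' :: "real \<Rightarrow> real"
  assumes H: "\<And>s. (H has_real_derivative H' s) (at s)"
    and H': "\<And>s. (H' has_real_derivative H'' s) (at s)"
    and H'': "continuous_on UNIV H''"
  shows "C2_fun (\<lambda>z::'n::finite heis. H (koranyi4 z))"
proof -
  have cont: "continuous_on S (\<lambda>z::'n heis. F (koranyi4 z))"
    if "continuous_on UNIV F" for F :: "real \<Rightarrow> real" and S
    by (rule continuous_on_compose2[OF that]) (auto intro!: continuous_intros)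
  have cH: "continuous_on UNIV H" "continuous_on UNIV H'"
    by (auto intro!: continuous_at_imp_continuous_on DERIV_isCont[OF H] DERIV_isCont[OF H'])
  have pd: "pderiv_dir e (\<lambda>z::'n heis. H (koranyi4 z)) = (\<lambda>z. H' (koranyi4 z) * dkoranyi4 e z)" for e
    by (intro ext pderiv_dir_eqI dderiv_radial H)
  have 1: "C1_fun (\<lambda>z::'n heis. H (koranyi4 z))"
    by (rule C1_funI[where D = "\<lambda>e z. H' (koranyi4 z) * dkoranyi4 e z"])
       (auto intro!: cont cH dderiv_radial H continuous_intros)
  have 2: "C1_fun (\<lambda>z::'n heis. H' (koranyi4 z) * dkoranyi4 e z)" for e
  proof (rule C1_funI[where D = "\<lambda>d z. H'' (koranyi4 z) * dkoranyi4 d z * dkoranyi4 e z + H' (koranyi4 z) *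
       (8 * hinner z d * hinner z e + 4 * hinner z z * hinner d e + 2 * snd (snd d) * snd (snd e))"])
    show "((\<lambda>s. H' (koranyi4 (z + s *\<^sub>R d)) * dkoranyi4 e (z + s *\<^sub>R d)) has_real_derivative
        H'' (koranyi4 z) * dkoranyi4 d z * dkoranyi4 e z + H' (koranyi4 z) *
        (8 * hinner z d * hinner z e + 4 * hinner z z * hinner d e + 2 * snd (snd d) * snd (snd e)))
        (at 0)" for d z
      using DERIV_mult[OF dderiv_radial[OF H', of z d] dderiv_dkoranyi4[of e z d]]
      by (simp add: algebra_simps)
  qed (intro continuous_intros cont cH H'')+
  show ?thesis
    unfolding C2_fun_def pd using 1 2 by blast
qed

lemma X_field_eqI:
  assumes "\<And>e. ((\<lambda>s. g (z + s *\<^sub>R e)) has_real_derivative D e) (at 0)"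
  shows "X_field i g z = D (axis i 1, 0, 0) + 2 * (fst (snd z) $ i) * D (0, 0, 1)"
    and "Y_field i g z = D (0, axis i 1, 0) - 2 * (fst z $ i) * D (0, 0, 1)"
  using pderiv_dir_eqI[OF assms] by (cases z; simp add: X_field_def Y_field_def)+

text \<open>Write \<open>P = |z|^4\<close>, \<open>q = |x|\<^sup>2 + |y|\<^sup>2\<close> and \<open>k(s) = s^(-m/2) H'(s)\<close>. The weighted horizontal
  gradient of \<open>H(P)\<close> is \<open>k(P) \<nabla>\<^sub>H P\<close>, so minus \<open>L_H\<close> of \<open>H(P)\<close> is
  \<open>k'(P) |\<nabla>\<^sub>H P|\<^sup>2 + k(P) \<Delta>\<^sub>H P\<close>, and \<open>|\<nabla>\<^sub>H P|\<^sup>2 = 16 P q\<close>, \<open>\<Delta>\<^sub>H P = (16 + 8N) q\<close>.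
  Vanishing of \<open>H'\<close> near \<open>0\<close> makes \<open>k\<close> differentiable on the whole line, hence the formula is also
  valid at the origin.\<close>

lemma L_H_radial:
  fixes H H' H'' :: "real \<Rightarrow> real" and z :: "'n::finite heis"
  assumes H: "\<And>s. (H has_real_derivative H' s) (at s)"
    and H': "\<And>s. (H' has_real_derivative H'' s) (at s)"
    and sg: "0 < \<sigma>" "\<And>s. s \<le> \<sigma> \<Longrightarrow> H' s = 0"
  shows "L_H m (\<lambda>z. H (koranyi4 z)) z =
     - (hinner z z * koranyi4 z powr (- m / 2) *
         (16 * koranyi4 z * H'' (koranyi4 z) + (16 + 8 * real CARD('n) - 8 * m) * H' (koranyi4 z)))"
proof -
  define k where "k = (\<lambda>s. s powr (- m / 2) * H' s)"
  define k' where "k' = (\<lambda>s. s powr (- m / 2) * H'' s - m / 2 * (s powr (- m / 2 - 1) * H' s))"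
  have H''0: "H'' s = 0" if "s < \<sigma>" for s
  proof -
    have "(H' has_real_derivative 0) (at s)"
      by (rule has_field_derivative_transform_within_open[where S = "{..<\<sigma>}" and f = "\<lambda>_. 0"])
         (use sg that in auto)
    then show ?thesis using H' DERIV_unique by blast
  qed
  have k: "(k has_real_derivative k' s) (at s)" for s
  proof (cases "s < \<sigma>")
    case True
    have "((\<lambda>_. 0) has_real_derivative k' s) (at s)"
      using True sg H''0 by (simp add: k'_def)
    then show ?thesis
      by (rule has_field_derivative_transform_within_open[where S = "{..<\<sigma>}"])
         (use sg True in \<open>auto simp: k_def\<close>)
  next
    case False
    then have "0 < s" using sg by simp
    then show ?thesis
      unfolding k_def k'_def
      by (auto intro!: derivative_eq_intros H' simp: algebra_simps)
  qed
  \<comment> \<open>The horizontal gradient of the polynomial \<open>P\<close> has components \<open>Gx\<close> and \<open>Gy\<close>.\<close>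
  define Gx where "Gx = (\<lambda>i (z::'n heis). 4 * hinner z z * (fst z $ i) + 4 * (fst (snd z) $ i) * snd (snd z))"
  define Gy where "Gy = (\<lambda>i (z::'n heis). 4 * hinner z z * (fst (snd z) $ i) - 4 * (fst z $ i) * snd (snd z))"
  have X: "X_field i (\<lambda>z. H (koranyi4 z)) z = H' (koranyi4 z) * Gx i z"
    and Y: "Y_field i (\<lambda>z. H (koranyi4 z)) z = H' (koranyi4 z) * Gy i z" for i and z :: "'n heis"
    unfolding X_field_eqI[OF dderiv_radial[OF H]] Gx_def Gy_def
    by (simp_all add: dkoranyi4_def hinner_def inner_axis algebra_simps)
  have "(\<lambda>z. fst (koranyi z powr (- 2 * m) *\<^sub>R hgrad (\<lambda>z. H (koranyi4 z)) z) $ i)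
      = (\<lambda>z. k (koranyi4 z) * Gx i z)" 
    and "(\<lambda>z. snd (koranyi z powr (- 2 * m) *\<^sub>R hgrad (\<lambda>z. H (koranyi4 z)) z) $ i)
      = (\<lambda>z. k (koranyi4 z) * Gy i z)" for i
    by (auto simp: hgrad_def X Y koranyi_powr k_def)
  note F = this
  have dGx: "((\<lambda>s. Gx i (z + s *\<^sub>R e)) has_real_derivative
      8 * hinner z e * (fst z $ i) + 4 * hinner z z * (fst e $ i)
      + 4 * (fst (snd e) $ i) * snd (snd z) + 4 * (fst (snd z) $ i) * snd (snd e)) (at 0)" for i e
    unfolding Gx_def by (auto intro!: derivative_eq_intros dderiv_hinner_self)
  have dGy: "((\<lambda>s. Gy i (z + s *\<^sub>R e)) has_real_derivative
      8 * hinner z e * (fst (snd z) $ i) + 4 * hinner z z * (fst (snd e) $ i)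
      - 4 * (fst e $ i) * snd (snd z) - 4 * (fst z $ i) * snd (snd e)) (at 0)" for i e
    unfolding Gy_def by (auto intro!: derivative_eq_intros dderiv_hinner_self)
  have XX: "X_field i (\<lambda>z. k (koranyi4 z) * Gx i z) z = k' (koranyi4 z) * (Gx i z)\<^sup>2
       + k (koranyi4 z) * (4 * hinner z z + 8 * (fst z $ i)\<^sup>2 + 8 * (fst (snd z) $ i)\<^sup>2)" for i
    unfolding X_field_eqI(1)[OF DERIV_mult[OF dderiv_radial[OF k] dGx]]
    by (simp add: Gx_def dkoranyi4_def hinner_def inner_axis algebra_simps power2_eq_square
        flip: zero_prod_def)
  have YY: "Y_field i (\<lambda>z. k (koranyi4 z) * Gy i z) z = k' (koranyi4 z) * (Gy i z)\<^sup>2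
       + k (koranyi4 z) * (4 * hinner z z + 8 * (fst z $ i)\<^sup>2 + 8 * (fst (snd z) $ i)\<^sup>2)" for i
    unfolding X_field_eqI(2)[OF DERIV_mult[OF dderiv_radial[OF k] dGy]]
    by (simp add: Gy_def dkoranyi4_def hinner_def inner_axis algebra_simps power2_eq_square
        flip: zero_prod_def)
  have G2: "(Gx i z)\<^sup>2 + (Gy i z)\<^sup>2 = 16 * koranyi4 z * ((fst z $ i)\<^sup>2 + (fst (snd z) $ i)\<^sup>2)" for i
    unfolding Gx_def Gy_def koranyi4_def by (simp add: algebra_simps power2_eq_square)
  have S: "k' (koranyi4 z) * (Gx i z)\<^sup>2
       + k (koranyi4 z) * (4 * hinner z z + 8 * (fst z $ i)\<^sup>2 + 8 * (fst (snd z) $ i)\<^sup>2)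
       + (k' (koranyi4 z) * (Gy i z)\<^sup>2
       + k (koranyi4 z) * (4 * hinner z z + 8 * (fst z $ i)\<^sup>2 + 8 * (fst (snd z) $ i)\<^sup>2))
     = 16 * koranyi4 z * k' (koranyi4 z) * ((fst z $ i)\<^sup>2 + (fst (snd z) $ i)\<^sup>2)
      + k (koranyi4 z) * (8 * hinner z z + 16 * ((fst z $ i)\<^sup>2 + (fst (snd z) $ i)\<^sup>2))" for i
  proof -
    have "k' (koranyi4 z) * (Gx i z)\<^sup>2 + k' (koranyi4 z) * (Gy i z)\<^sup>2
        = k' (koranyi4 z) * (16 * koranyi4 z * ((fst z $ i)\<^sup>2 + (fst (snd z) $ i)\<^sup>2))"
      by (simp only: distrib_left[symmetric] G2)
    then show ?thesis by (simp add: algebra_simps)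
  qed
  have "L_H m (\<lambda>z. H (koranyi4 z)) z = - (\<Sum>i\<in>UNIV.
      16 * koranyi4 z * k' (koranyi4 z) * ((fst z $ i)\<^sup>2 + (fst (snd z) $ i)\<^sup>2)
      + k (koranyi4 z) * (8 * hinner z z + 16 * ((fst z $ i)\<^sup>2 + (fst (snd z) $ i)\<^sup>2)))"
    unfolding L_H_def hdiv_def F XX YY S ..
  also have "\<dots> = - (16 * koranyi4 z * k' (koranyi4 z) * hinner z z
      + k (koranyi4 z) * (8 * real CARD('n) * hinner z z + 16 * hinner z z))"
    by (simp add: sum.distrib sum_distrib_left[symmetric] hinner_self_sum)
  also have "\<dots> = - (hinner z z * koranyi4 z powr (- m / 2) *
         (16 * koranyi4 z * H'' (koranyi4 z) + (16 + 8 * real CARD('n) - 8 * m) * H' (koranyi4 z)))"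
  proof (cases "koranyi4 z = 0")
    case True
    then show ?thesis using sg by (simp add: k_def)
  next
    case False
    then have "0 < koranyi4 z" using koranyi4_nonneg[of z] by linarith
    then have "koranyi4 z * koranyi4 z powr (- m / 2 - 1) = koranyi4 z powr (- m / 2)"
      by (simp add: powr_diff)
    then have "koranyi4 z * k' (koranyi4 z) = koranyi4 z powr (- m / 2) * (koranyi4 z * H'' (koranyi4 z) - m / 2 * H' (koranyi4 z))"
      unfolding k'_def by (simp add: algebra_simps) 
    then have "16 * koranyi4 z * k' (koranyi4 z) * hinner z z = 16 * (koranyi4 z powr (- m / 2) * (koranyi4 z * H'' (koranyi4 z) - m / 2 * H' (koranyi4 z))) * hinner z z"
      by (simp add: mult.assoc)
    then show ?thesis unfolding k_def by (simp add: algebra_simps)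
  qed
  finally show ?thesis .
qed

text \<open>The derivatives of \<open>h(P/R^4)\<close> live where \<open>P\<close> has order \<open>R^4\<close>; there \<open>q \<le> 2 R\<^sup>2\<close>, so each of the two
  terms of the radial formula has order \<open>R\<^sup>2 R\<^sup>-\<^sup>4 P^(-m/2)\<close>. The scalar \<open>c\<close> is the value of the time
  cut-off.\<close>

lemma L_H_cutoff_bound:
  fixes h h' h'' :: "real \<Rightarrow> real" and z :: "'n::finite heis"
  assumes h: "\<And>s. (h has_real_derivative h' s) (at s)" "\<And>s. (h' has_real_derivative h'' s) (at s)"
    and h0: "\<And>s. s \<le> 1 \<Longrightarrow> h' s = 0" "\<And>s. s \<ge> 2 \<Longrightarrow> h s = 0"
    and C: "0 < C" "\<And>s. \<bar>h' s\<bar> \<le> C * h s powr q" "\<And>s. \<bar>h'' s\<bar> \<le> C * h s powr q"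
    and R: "0 < R"
  shows "\<bar>L_H m (\<lambda>z. c * h (koranyi4 z / R ^ 4)) z\<bar>
     \<le> \<bar>c\<bar> * (2 * (32 + \<bar>16 + 8 * real CARD('n) - 8 * m\<bar>) * C / R\<^sup>2 * koranyi z powr (- 2 * m)
         * h (koranyi4 z / R ^ 4) powr q)"
proof -
  define H' where "H' = (\<lambda>s. c * (h' (s / R ^ 4) / R ^ 4))"
  define H'' where "H'' = (\<lambda>s. c * (h'' (s / R ^ 4) / R ^ 4 / R ^ 4))"
  define P where "P = koranyi4 z"
  define \<eta> where "\<eta> = h (P / R ^ 4) powr q"
  define b where "b = 16 + 8 * real CARD('n) - 8 * m"
  have R4: "0 < R ^ 4" using R by simp
  have dscale: "((\<lambda>s. s / R ^ 4) has_real_derivative 1 / R ^ 4) (at s)" for s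
    by (rule DERIV_cdivide[OF DERIV_ident])
  have dH: "((\<lambda>s. c * h (s / R ^ 4)) has_real_derivative H' s) (at s)" for s
    unfolding H'_def
    using DERIV_cmult[OF DERIV_chain2[OF h(1) dscale[of s]], of c] by simp
  have dH': "(H' has_real_derivative H'' s) (at s)" for s
    unfolding H'_def H''_def
    using DERIV_cmult[OF DERIV_cdivide[OF DERIV_chain2[OF h(2) dscale[of s]], of "R ^ 4"], of c]
    by simp
  have H'0: "H' s = 0" if "s \<le> R ^ 4" for s
    using h0(1)[of "s / R ^ 4"] that R4 by (simp add: H'_def)
  have L: "L_H m (\<lambda>z. c * h (koranyi4 z / R ^ 4)) z
     = - (hinner z z * P powr (- m / 2) * (16 * P * H'' P + b * H' P))"
    unfolding P_def b_def
    by (rule L_H_radial[OF dH dH' R4 H'0])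
  have w: "P powr (- m / 2) = koranyi z powr (- 2 * m)"
    by (simp add: koranyi_powr P_def)
  have \<eta>0: "0 \<le> \<eta>" by (simp add: \<eta>_def)
  have P0: "0 \<le> P" by (simp add: P_def)
  show ?thesis
  proof (cases "P \<le> 2 * R ^ 4")
    case False
    then have z0: "h (P / R ^ 4) = 0"
      using R4 by (intro h0) (simp add: field_simps)
    then have "h' (P / R ^ 4) = 0" "h'' (P / R ^ 4) = 0"
      using C(2,3)[of "P / R ^ 4"] by auto
    then show ?thesis
      unfolding L P_def[symmetric] by (simp add: H'_def H''_def z0)
  next
    case True
    have "hinner z z \<le> sqrt P" by (simp add: P_def hinner_le)
    also have "\<dots> \<le> sqrt ((2 * R\<^sup>2)\<^sup>2)"
    proof (rule real_sqrt_le_mono)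
      have "P \<le> 4 * R ^ 4" using True R4 by linarith
      then show "P \<le> (2 * R\<^sup>2)\<^sup>2" by (simp add: power_mult_distrib)
    qed
    also have "\<dots> = 2 * R\<^sup>2" using R by (simp only: real_sqrt_abs) simp
    finally have q: "hinner z z \<le> 2 * R\<^sup>2" .
    have bH': "\<bar>H' P\<bar> \<le> \<bar>c\<bar> * (C * \<eta> / R ^ 4)"
      unfolding H'_def abs_mult \<eta>_def using C(2)[of "P / R ^ 4"] R4
      by (intro mult_left_mono) (auto simp: abs_divide divide_right_mono)
    have bH'': "\<bar>H'' P\<bar> \<le> \<bar>c\<bar> * (C * \<eta> / R ^ 4 / R ^ 4)"
      unfolding H''_def abs_mult \<eta>_def using C(3)[of "P / R ^ 4"] R4
      by (intro mult_left_mono) (auto simp: abs_divide divide_right_mono)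
    have "\<bar>16 * P * H'' P + b * H' P\<bar> \<le> 16 * P * \<bar>H'' P\<bar> + \<bar>b\<bar> * \<bar>H' P\<bar>"
      using P0 by (intro order_trans[OF abs_triangle_ineq]) (simp add: abs_mult)
    also have "\<dots> \<le> 16 * (2 * R ^ 4) * (\<bar>c\<bar> * (C * \<eta> / R ^ 4 / R ^ 4)) + \<bar>b\<bar> * (\<bar>c\<bar> * (C * \<eta> / R ^ 4))"
      using True P0 R4 bH' bH'' by (intro add_mono mult_mono) auto
    also have "\<dots> = \<bar>c\<bar> * ((32 + \<bar>b\<bar>) * C * \<eta> / R ^ 4)"
      using R4 by (simp add: field_simps)
    finally have in_le: "\<bar>16 * P * H'' P + b * H' P\<bar> \<le> \<bar>c\<bar> * ((32 + \<bar>b\<bar>) * C * \<eta> / R ^ 4)" .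
    have "\<bar>L_H m (\<lambda>z. c * h (koranyi4 z / R ^ 4)) z\<bar>
        = hinner z z * P powr (- m / 2) * \<bar>16 * P * H'' P + b * H' P\<bar>"
      unfolding L by (simp add: abs_mult)
    also have "\<dots> \<le> (2 * R\<^sup>2) * P powr (- m / 2) * (\<bar>c\<bar> * ((32 + \<bar>b\<bar>) * C * \<eta> / R ^ 4))"
      using q in_le by (intro mult_mono) auto
    also have "\<dots> = \<bar>c\<bar> * (2 * (32 + \<bar>b\<bar>) * C / R\<^sup>2 * P powr (- m / 2) * \<eta>)"
      using R by (simp add: field_simps power2_eq_square power4_eq_xxxx)
    finally show ?thesis
      unfolding w unfolding \<eta>_def b_def P_def .
  qed
qed

section \<open>Integrals of powers of the Koranyi norm and product integrals\<close>

text \<open>Koranyi balls are comparable to boxes that have side \<open>\<rho>\<close> in the horizontal and \<open>\<rho>\<^sup>2\<close> in the vertical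
  direction; this is where the homogeneous dimension \<open>Q = 2N + 2\<close> enters.\<close>

lemma koranyi4_sublevel_subset_cbox:
  fixes \<rho> :: real
  assumes "0 \<le> \<rho>"
  shows "{z::'n::finite heis. koranyi4 z \<le> \<rho> ^ 4} \<subseteq>
     cbox ((\<chi> i. - \<rho>), (\<chi> i. - \<rho>), - \<rho>\<^sup>2) ((\<chi> i. \<rho>), (\<chi> i. \<rho>), \<rho>\<^sup>2)"
proof
  fix z :: "'n heis" assume "z \<in> {z. koranyi4 z \<le> \<rho> ^ 4}"
  then have z: "koranyi4 z \<le> (\<rho>\<^sup>2)\<^sup>2" by simp
  obtain x y w where xyw: "z = (x, y, w)" by (metis surj_pair)
  have "(hinner z z)\<^sup>2 \<le> (\<rho>\<^sup>2)\<^sup>2" "w\<^sup>2 \<le> (\<rho>\<^sup>2)\<^sup>2"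
    using z by (auto simp: koranyi4_def xyw intro: order_trans[rotated])
  then have q: "hinner z z \<le> \<rho>\<^sup>2" and w: "\<bar>w\<bar> \<le> \<rho>\<^sup>2"
    using power2_le_imp_le[of "hinner z z" "\<rho>\<^sup>2"] power2_le_imp_le[of "\<bar>w\<bar>" "\<rho>\<^sup>2"] by simp_all
  have "\<bar>x $ i\<bar> \<le> \<rho> \<and> \<bar>y $ i\<bar> \<le> \<rho>" for i
  proof -
    have "(x $ i)\<^sup>2 + (y $ i)\<^sup>2 \<le> hinner z z"
      unfolding hinner_self_sum xyw fst_conv snd_conv
      by (rule member_le_sum) auto
    then have "(x $ i)\<^sup>2 \<le> \<rho>\<^sup>2" "(y $ i)\<^sup>2 \<le> \<rho>\<^sup>2" 
      using q zero_le_power2[of "x $ i"] zero_le_power2[of "y $ i"] by linarith+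
    then show ?thesis
      using assms abs_le_square_iff[of "x $ i" \<rho>] abs_le_square_iff[of "y $ i" \<rho>] by simp
  qed
  then show "z \<in> cbox ((\<chi> i. - \<rho>), (\<chi> i. - \<rho>), - \<rho>\<^sup>2) ((\<chi> i. \<rho>), (\<chi> i. \<rho>), \<rho>\<^sup>2)"
    using w by (auto simp: xyw cbox_Pair_eq mem_box_cart abs_le_iff minus_le_iff)
qed

lemma compact_koranyi4_sublevel: "compact {z::'n::finite heis. koranyi4 z \<le> c}"
proof -
  have "c \<le> (1 + \<bar>c\<bar>) ^ 1" by simp
  also have "\<dots> \<le> (1 + \<bar>c\<bar>) ^ 4" by (rule power_increasing) auto
  finally have "{z::'n::finite heis. koranyi4 z \<le> c} \<subseteq> {z. koranyi4 z \<le> (1 + \<bar>c\<bar>) ^ 4}" by auto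
  note sub = order_trans[OF this koranyi4_sublevel_subset_cbox]
  have "bounded {z::'n::finite heis. koranyi4 z \<le> c}"
    by (rule bounded_subset[OF bounded_cbox sub]) simp
  moreover have "closed {z::'n::finite heis. koranyi4 z \<le> c}"
    by (intro closed_Collect_le continuous_intros)
  ultimately show ?thesis by (simp add: compact_eq_bounded_closed)
qed

lemma emeasure_koranyi4_sublevel_le:
  fixes \<rho> :: real
  assumes "0 \<le> \<rho>"
  shows "emeasure lborel {z::'n::finite heis. koranyi4 z \<le> \<rho> ^ 4}
    \<le> ennreal (2 ^ (2 * CARD('n) + 1) * \<rho> ^ (2 * CARD('n) + 2))"
proof -
  let ?a = "((\<chi> i. - \<rho>), (\<chi> i. - \<rho>), - \<rho>\<^sup>2) :: 'n heis"
  let ?b = "((\<chi> i. \<rho>), (\<chi> i. \<rho>), \<rho>\<^sup>2) :: 'n heis"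
  have ne: "cbox (\<chi> i::'n. - \<rho>) (\<chi> i. \<rho>) \<noteq> {}"
    using assms by (auto simp: mem_box_cart intro!: exI[of _ 0] simp flip: ex_in_conv)
  have "measure lborel (cbox ?a ?b) = (2 * \<rho>) ^ CARD('n) * ((2 * \<rho>) ^ CARD('n) * (2 * \<rho>\<^sup>2))"
    unfolding content_Pair content_cbox_cart[OF ne] using assms by simp
  also have "\<dots> = 2 ^ (2 * CARD('n) + 1) * \<rho> ^ (2 * CARD('n) + 2)"
    by (simp add: power_mult_distrib power_add power_even_eq power2_eq_square)
  finally have c: "measure lborel (cbox ?a ?b) = 2 ^ (2 * CARD('n) + 1) * \<rho> ^ (2 * CARD('n) + 2)" .
  have "emeasure lborel {z::'n heis. koranyi4 z \<le> \<rho> ^ 4} \<le> emeasure lborel (cbox ?a ?b)"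
    by (intro emeasure_mono koranyi4_sublevel_subset_cbox assms) auto
  also have "\<dots> = ennreal (measure lborel (cbox ?a ?b))"
    by (rule emeasure_eq_ennreal_measure) (auto simp: emeasure_lborel_cbox_eq)
  finally show ?thesis unfolding c .
qed

lemma borel_measurable_koranyi4 [measurable]: "koranyi4 \<in> borel_measurable borel"
  by (intro borel_measurable_continuous_onI continuous_intros)

text \<open>Cut the ball into the dyadic shells \<open>\<rho>/2^(k+1) < |z| \<le> \<rho>/2^k\<close>. On the \<open>k\<close>-th shell the weight
  \<open>|z|^(-m)\<close> is at most \<open>(\<rho>/2^(k+1))^(-m)\<close>, and its volume is at most \<open>const (\<rho>/2^k)^Q\<close>, so the
  contributions form a geometric series of ratio \<open>2^(m-Q) < 1\<close>.\<close>

lemma nn_integral_koranyi4_weight_le: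
  fixes m :: real
  assumes m: "0 \<le> m" "m < 2 * real CARD('n) + 2"
  shows "\<exists>K\<ge>0. \<forall>\<rho>>0.
    (\<integral>\<^sup>+(z::'n::finite heis). ennreal (koranyi4 z powr (- m / 4)) * indicator {z. koranyi4 z \<le> \<rho> ^ 4} z \<partial>lborel)
      \<le> ennreal (K * \<rho> powr (2 * real CARD('n) + 2 - m))"
proof -
  define d where "d = 2 * CARD('n) + 2"
  define \<theta> where "\<theta> = 2 powr (m - real d)"
  have \<theta>: "0 < \<theta>" "\<theta> < 1"
    using m by (auto simp: \<theta>_def d_def powr_less_one)
  define K where "K = 2 ^ (d - 1) * 2 powr m * (1 / (1 - \<theta>))"
  have K0: "K \<ge> 0" using \<theta> by (simp add: K_def)
  have main: "(\<integral>\<^sup>+(z::'n heis). ennreal (koranyi4 z powr (- m / 4)) * indicator {z. koranyi4 z \<le> \<rho> ^ 4} z \<partial>lborel)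
      \<le> ennreal (K * \<rho> powr (real d - m))" if \<rho>: "\<rho> > 0" for \<rho>
  proof -
    define c where "c = (\<lambda>k::nat. (\<rho> / 2 ^ (k + 1)) powr (- m))"
    define S where "S = (\<lambda>k::nat. {z::'n heis. koranyi4 z \<le> (\<rho> / 2 ^ k) ^ 4})"
    have S_meas [measurable]: "S k \<in> sets borel" for k
      unfolding S_def by measurable
    \<comment> \<open>Each point of the punctured ball lies in one dyadic shell.\<close>
    have pt: "ennreal (koranyi4 z powr (- m / 4)) * indicator {z. koranyi4 z \<le> \<rho> ^ 4} z
        \<le> (\<Sum>k. ennreal (c k) * indicator (S k) z)" for z :: "'n heis"
    proof (cases "koranyi4 z = 0 \<or> koranyi4 z > \<rho> ^ 4")
      case True
      then show ?thesis by auto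
    next
      case False
      then have pos: "0 < koranyi4 z" and le: "koranyi4 z \<le> \<rho> ^ 4"
        using koranyi4_nonneg[of z] by (auto simp: less_le)
      define r where "r = koranyi4 z powr (1 / 4)"
      have r0: "0 < r" using pos by (simp add: r_def)
      have r4: "r ^ 4 = koranyi4 z"
        using pos by (simp add: r_def powr_powr flip: powr_realpow)
      have r\<rho>: "r \<le> \<rho>"
        using le \<rho> r0 unfolding r4[symmetric] by (simp add: power_mono_iff)
      obtain j :: nat where j: "\<rho> / r < 2 ^ j"
        using real_arch_pow[of 2 "\<rho> / r"] by auto
      define k where "k = (LEAST j. \<rho> / 2 ^ (j + 1) < r)"
      have ex: "\<rho> / 2 ^ (j + 1) < r"
      proof -
        have "\<rho> < 2 ^ j * r" using j r0 by (simp add: field_simps)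
        also have "\<dots> \<le> 2 ^ (j + 1) * r" using r0 by simp
        finally show ?thesis by (simp add: field_simps)
      qed
      then have k1: "\<rho> / 2 ^ (k + 1) < r"
        unfolding k_def by (rule LeastI)
      have k2: "r \<le> \<rho> / 2 ^ k"
      proof (cases k)
        case 0
        then show ?thesis using r\<rho> by simp
      next
        case (Suc i)
        then have "\<not> \<rho> / 2 ^ (i + 1) < r"
          using not_less_Least[of i "\<lambda>j. \<rho> / 2 ^ (j + 1) < r"] by (simp add: k_def)
        then show ?thesis using Suc by simp
      qed
      have "koranyi4 z \<le> (\<rho> / 2 ^ k) ^ 4"
        unfolding r4[symmetric] using k2 r0 by (intro power_mono) auto
      then have zS: "z \<in> S k" by (simp add: S_def)
      have "koranyi4 z powr (- m / 4) = r powr (- m)"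
        by (simp add: r_def powr_powr)
      also have "\<dots> \<le> c k"
        unfolding c_def using k1 \<rho> m by (intro powr_mono2') auto
      finally have "ennreal (koranyi4 z powr (- m / 4)) * indicator {z. koranyi4 z \<le> \<rho> ^ 4} z
          \<le> ennreal (c k) * indicator (S k) z"
        using le zS by (simp add: ennreal_leI)
      also have "\<dots> \<le> (\<Sum>k. ennreal (c k) * indicator (S k) z)"
        using sum_le_suminf[of "\<lambda>k. ennreal (c k) * indicator (S k) z" "{k}"]
        by (simp del: sum_mult_indicator)
      finally show ?thesis .
    qed
    have term_le: "(\<integral>\<^sup>+z. ennreal (c k) * indicator (S k) z \<partial>lborel)
        \<le> ennreal (2 ^ (d - 1) * 2 powr m * \<rho> powr (real d - m) * \<theta> ^ k)" for k
    proof -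
      have "(\<integral>\<^sup>+z. ennreal (c k) * indicator (S k) z \<partial>lborel) = ennreal (c k) * emeasure lborel (S k)"
        by (subst nn_integral_cmult_indicator) auto
      also have "\<dots> \<le> ennreal (c k) * ennreal (2 ^ (d - 1) * (\<rho> / 2 ^ k) ^ d)"
        unfolding S_def using \<rho> emeasure_koranyi4_sublevel_le[where 'n='n, of "\<rho> / 2 ^ k"]
        by (intro mult_left_mono) (auto simp: d_def)
      also have "\<dots> = ennreal (c k * (2 ^ (d - 1) * (\<rho> / 2 ^ k) ^ d))"
        using \<rho> by (subst ennreal_mult) (auto simp: c_def)
      also have "c k * (2 ^ (d - 1) * (\<rho> / 2 ^ k) ^ d)
          = 2 ^ (d - 1) * 2 powr m * \<rho> powr (real d - m) * \<theta> ^ k"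
      proof -
        have e2: "(2::real) ^ j = 2 powr real j" for j by (simp add: powr_realpow)
        have "c k = \<rho> powr (- m) * 2 powr (m * (real k + 1))"
          unfolding c_def e2 using \<rho>
          by (simp add: powr_divide powr_powr powr_minus_divide add_ac mult_ac)
        moreover have "(\<rho> / 2 ^ k) ^ d = \<rho> powr real d * 2 powr (- (real k * real d))"
        proof -
          have "2 powr (- (real k * real d)) = 1 / 2 ^ (k * d)"
            by (simp add: powr_minus_divide powr_realpow flip: of_nat_mult)
          then show ?thesis
            using \<rho> by (simp add: power_divide powr_realpow flip: power_mult)
        qed
        moreover have "\<theta> ^ k = 2 powr (m * real k) * 2 powr (- (real k * real d))"
          unfolding \<theta>_def by (simp add: powr_power powr_add[symmetric] algebra_simps)
        moreover have "\<rho> powr (real d - m) = \<rho> powr real d * \<rho> powr (- m)"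
          by (simp add: powr_add[symmetric])
        moreover have "2 powr (m * (real k + 1)) = 2 powr (m * real k) * 2 powr m"
          by (simp add: powr_add[symmetric] algebra_simps)
        ultimately show ?thesis by simp
      qed
      finally show ?thesis .
    qed
    have sums: "(\<lambda>k. 2 ^ (d - 1) * 2 powr m * \<rho> powr (real d - m) * \<theta> ^ k)
        sums (2 ^ (d - 1) * 2 powr m * \<rho> powr (real d - m) * (1 / (1 - \<theta>)))"
      using \<theta> by (intro sums_mult geometric_sums) auto
    have "(\<integral>\<^sup>+(z::'n heis). ennreal (koranyi4 z powr (- m / 4)) * indicator {z. koranyi4 z \<le> \<rho> ^ 4} z \<partial>lborel)
        \<le> (\<integral>\<^sup>+z. (\<Sum>k. ennreal (c k) * indicator (S k) z) \<partial>lborel)"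
      by (intro nn_integral_mono pt)
    also have "\<dots> = (\<Sum>k. \<integral>\<^sup>+z. ennreal (c k) * indicator (S k) z \<partial>lborel)"
      by (intro nn_integral_suminf) measurable
    also have "\<dots> \<le> (\<Sum>k. ennreal (2 ^ (d - 1) * 2 powr m * \<rho> powr (real d - m) * \<theta> ^ k))"
      by (intro suminf_le term_le) auto
    also have "\<dots> = ennreal (2 ^ (d - 1) * 2 powr m * \<rho> powr (real d - m) * (1 / (1 - \<theta>)))"
      using \<theta> by (intro suminf_ennreal_eq sums) auto
    finally show ?thesis by (simp add: K_def mult_ac)
  qed
  have d: "2 * real CARD('n) + 2 - m = real d - m" by (simp add: d_def)
  show ?thesis
    unfolding d by (intro exI[of _ K] conjI allI impI K0 main)
qed

lemma borel_measurable_time_slab: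
  fixes w :: "'a::euclidean_space \<Rightarrow> real"
  assumes [measurable]: "w \<in> borel_measurable borel"
  shows "(\<lambda>(t, z). indicator {0<..<T::real} t * w z) \<in> borel_measurable lborel"
  unfolding lborel_prod[symmetric] by measurable

lemma nn_integral_time_slab:
  fixes w :: "'a::euclidean_space \<Rightarrow> ennreal"
  assumes [measurable]: "w \<in> borel_measurable borel" and "0 \<le> T"
  shows "(\<integral>\<^sup>+(t, z). indicator {0<..<T} t * w z \<partial>(lborel :: (real \<times> 'a) measure))
    = ennreal T * (\<integral>\<^sup>+z. w z \<partial>lborel)"
proof -
  have "(\<integral>\<^sup>+(t, z). indicator {0<..<T} t * w z \<partial>(lborel :: (real \<times> 'a) measure))
      = (\<integral>\<^sup>+t. \<integral>\<^sup>+z. indicator {0<..<T::real} t * w z \<partial>lborel \<partial>lborel)"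
    unfolding lborel_prod[symmetric] by (subst lborel.nn_integral_fst[symmetric]) auto
  also have "\<dots> = (\<integral>\<^sup>+t. indicator {0<..<T::real} t * (\<integral>\<^sup>+z. w z \<partial>lborel) \<partial>lborel)"
    by (intro nn_integral_cong nn_integral_cmult) auto
  also have "\<dots> = ennreal T * (\<integral>\<^sup>+z. w z \<partial>lborel)"
    using \<open>0 \<le> T\<close> by (subst nn_integral_multc) auto
  finally show ?thesis .
qed

text \<open>Fubini's theorem for a product function that is only Lebesgue measurable. Replace \<open>g\<close> by a Borel
  function \<open>g'\<close> that agrees with it off a null set \<open>N\<close>; then \<open>UNIV \<times> N\<close> is a null set of the product.\<close>

lemma integral_product_completion:
  fixes a :: "real \<Rightarrow> real" and g :: "'a::euclidean_space \<Rightarrow> real"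
  assumes a: "integrable lborel a" and g: "integrable lebesgue g"
    and ag: "(\<lambda>(t, z). a t * g z) \<in> borel_measurable lebesgue"
  shows "(LINT x|lebesgue. (case x of (t, z) \<Rightarrow> a t * g z)) = (LINT t|lborel. a t) * (LINT z|lebesgue. g z)"
proof -
  have am [measurable]: "a \<in> borel_measurable borel"
    using a by (auto dest: borel_measurable_integrable)
  obtain g' where g'm: "g' \<in> borel_measurable lborel" and ae: "AE z in lborel. g z = g' z"
    using completion_ex_borel_measurable_real[OF borel_measurable_integrable[OF g]] by blast
  have g'm' [measurable]: "g' \<in> borel_measurable borel"
    using g'm by simp
  have gg': "(LINT z|lebesgue. g z) = (LINT z|lborel. g' z)"
    using g'm ae g
    by (subst integral_completion[symmetric], simp)
       (intro integral_cong_AE AE_completion; auto intro: measurable_completion)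
  have g'i: "integrable lborel g'"
  proof -
    have "integrable lebesgue g'"
      by (rule integrable_cong_AE_imp[OF g measurable_completion[OF g'm]])
         (use AE_completion[OF ae] in \<open>auto elim: eventually_mono\<close>)
    then show ?thesis using g'm by (simp add: integrable_completion)
  qed
  obtain N where N: "N \<in> null_sets lborel" "{z. g z \<noteq> g' z} \<subseteq> N"
    using ae by (auto elim!: AE_E simp: null_sets_def)
  have "UNIV \<times> N \<in> null_sets (lborel \<Otimes>\<^sub>M lborel :: (real \<times> 'a) measure)"
    using N by (auto simp: null_sets_def lborel.emeasure_pair_measure_Times simp del: sets_lborel)
  then have "AE x in (lborel :: (real \<times> 'a) measure). x \<notin> UNIV \<times> N"
    unfolding lborel_prod by (rule AE_not_in)
  then have ae2: "AE x in (lborel :: (real \<times> 'a) measure).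
      (case x of (t, z) \<Rightarrow> a t * g z) = (case x of (t, z) \<Rightarrow> a t * g' z)"
    by eventually_elim (use N in auto)
  have m2: "(\<lambda>(t, z). a t * g' z) \<in> borel_measurable (lborel :: (real \<times> 'a) measure)"
    unfolding lborel_prod[symmetric] by measurable
  have i2: "integrable (lborel \<Otimes>\<^sub>M lborel) (\<lambda>(t, z). a t * g' z)"
    using a g'i by (intro lborel_pair.Fubini_integrable) (auto simp: abs_mult)
  have "(LINT x|lebesgue. (case x of (t, z) \<Rightarrow> a t * g z))
      = (LINT x|lebesgue. (case x of (t, z) \<Rightarrow> a t * g' z))"
    by (intro integral_cong_AE ag measurable_completion[OF m2] AE_completion[OF ae2])
  also have "\<dots> = (LINT x|(lborel \<Otimes>\<^sub>M lborel). (case x of (t, z) \<Rightarrow> a t * g' z))"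
    using integral_completion[OF m2] by (simp add: lborel_prod)
  also have "\<dots> = (LINT t|lborel. LINT z|lborel. a t * g' z)"
    using lborel_pair.integral_fst'[OF i2] by simp
  also have "\<dots> = (LINT t|lborel. a t) * (LINT z|lebesgue. g z)"
    by (simp add: gg')
  finally show ?thesis .
qed

section \<open>The fractional integral and the time cut-off\<close>

lemma has_bochner_integral_powr_from_0:
  fixes c r :: real
  assumes r: "-1 < r" and c: "0 \<le> c"
  shows "has_bochner_integral lborel (\<lambda>x. indicator {0..c} x * x powr r) (c powr (r + 1) / (r + 1))"
proof -
  have i: "(\<lambda>x. x powr r) absolutely_integrable_on {0..c}"
    using has_integral_powr_from_0[OF r c]
    by (intro nonnegative_absolutely_integrable_1) (auto simp: integrable_on_def)
  have m: "(\<lambda>x. indicator {0..c} x * x powr r) \<in> borel_measurable lborel"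
    by measurable
  have "integrable lborel (\<lambda>x. indicator {0..c} x * x powr r)"
    using i integrable_completion[OF m] by (simp add: set_integrable_def)
  moreover have "(LINT x|lborel. indicator {0..c} x * x powr r) = c powr (r + 1) / (r + 1)"
  proof -
    have "(LINT x|lborel. indicator {0..c} x * x powr r) = (LINT x:{0..c}|lebesgue. x powr r)"
      using integral_completion[OF m] by (simp add: set_lebesgue_integral_def)
    also have "\<dots> = integral {0..c} (\<lambda>x. x powr r)"
      by (rule set_lebesgue_integral_eq_integral(2)[OF i])
    also have "\<dots> = c powr (r + 1) / (r + 1)"
      by (rule integral_unique[OF has_integral_powr_from_0[OF r c]])
    finally show ?thesis .
  qed
  ultimately show ?thesis by (simp add: has_bochner_integral_iff)
qed

text \<open>On \<open>[t, (t + T)/2]\<close> the function \<open>(1 - \<tau>/T)^n\<close> is at least \<open>((1 - t/T)/2)^n\<close>, and the kernel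
  \<open>(\<tau> - t)^(\<gamma>-1)\<close> integrates to \<open>((T - t)/2)^\<gamma> / \<gamma>\<close> over this interval; the rest of the integral
  is nonnegative.\<close>

lemma frac_int_pos_pow_ge:
  assumes g: "0 \<le> gam" "gam < 1" and n: "0 < n"
  shows "\<exists>c>0. \<forall>T>0. \<forall>t\<ge>0. c * T powr gam * max 0 (1 - t / T) powr (real n + gam)
           \<le> frac_int gam \<infinity> (\<lambda>\<tau>. pos_pow n (1 - \<tau> / T)) t"
proof (cases "gam = 0")
  case True
  have "1 * T powr gam * max 0 (1 - t / T) powr (real n + gam)
           \<le> frac_int gam \<infinity> (\<lambda>\<tau>. pos_pow n (1 - \<tau> / T)) t" if "T > 0" for T t
  proof -
    have "max 0 (1 - t / T) powr real n = max 0 (1 - t / T) ^ n"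
      using n by (cases "max 0 (1 - t / T) = 0") (simp, intro powr_realpow, linarith)
    then show ?thesis using that True by (simp add: frac_int_def pos_pow_def)
  qed
  then show ?thesis by (intro exI[of _ 1]) auto
next
  case False
  then have g0: "0 < gam" using g by simp
  define c where "c = 1 / Gamma gam * ((1 / 2) ^ n * ((1 / 2) powr gam / gam))"
  have G0: "0 < Gamma gam" using g0 by (rule Gamma_real_pos)
  have c0: "0 < c" using g0 G0 by (simp add: c_def)
  have "c * T powr gam * max 0 (1 - t / T) powr (real n + gam)
           \<le> frac_int gam \<infinity> (\<lambda>\<tau>. pos_pow n (1 - \<tau> / T)) t" if T: "T > 0" and t: "t \<ge> 0" for T t
  proof -
    define F where "F = (\<lambda>\<tau>. indicator {t<..} \<tau> * ((\<tau> - t) powr (gam - 1) * pos_pow n (1 - \<tau> / T)))"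
    have fi: "frac_int gam \<infinity> (\<lambda>\<tau>. pos_pow n (1 - \<tau> / T)) t = 1 / Gamma gam * (LINT \<tau>|lborel. F \<tau>)"
      using False by (simp add: frac_int_def interval_lebesgue_integral_def set_lebesgue_integral_def F_def)
    have F0: "0 \<le> F \<tau>" for \<tau> by (simp add: F_def)
    have shifted: "has_bochner_integral lborel (\<lambda>\<tau>. indicator {t..s} \<tau> * (\<tau> - t) powr (gam - 1))
        ((s - t) powr gam / gam)" if "t \<le> s" for s
    proof -
      have "has_bochner_integral lborel
        (\<lambda>x. indicator {0..s - t} (- t + 1 * x) * (- t + 1 * x) powr (gam - 1))
        (((s - t) powr (gam - 1 + 1) / (gam - 1 + 1)) /\<^sub>R \<bar>1\<bar>)"
        using has_bochner_integral_powr_from_0[of "gam - 1" "s - t"] g0 that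
        by (subst lborel_has_bochner_integral_real_affine_iff[symmetric]) auto
      moreover have "(\<lambda>x. indicator {0..s - t} (- t + 1 * x) * (- t + 1 * x) powr (gam - 1))
          = (\<lambda>x. indicator {t..s} x * (x - t) powr (gam - 1))"
        by (auto simp: indicator_def fun_eq_iff)
      ultimately show ?thesis by (simp only:) simp
    qed
    show ?thesis
    proof (cases "t < T")
      case False
      then have "max 0 (1 - t / T) = 0" using T by simp
      then show ?thesis
        unfolding fi using F0 G0 by (simp add: integral_nonneg_AE)
    next
      case True
      define s where "s = (t + T) / 2"
      have s: "t < s" "s < T" using True by (auto simp: s_def)
      have [measurable]: "F \<in> borel_measurable borel"
        unfolding F_def pos_pow_def by measurable
      have FI: "integrable lborel F"
      proof (rule Bochner_Integration.integrable_bound)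
        show "integrable lborel (\<lambda>\<tau>. indicator {t..T} \<tau> * (\<tau> - t) powr (gam - 1))"
          using shifted[of T] True by (simp add: has_bochner_integral_iff)
        show "AE \<tau> in lborel. norm (F \<tau>) \<le> norm (indicator {t..T} \<tau> * (\<tau> - t) powr (gam - 1))"
        proof (rule AE_I2)
          fix \<tau>
          show "norm (F \<tau>) \<le> norm (indicator {t..T} \<tau> * (\<tau> - t) powr (gam - 1))"
          proof (cases "t < \<tau> \<and> \<tau> \<le> T")
            case True
            then have "pos_pow n (1 - \<tau> / T) \<le> 1"
              using T t by (intro pos_pow_le_one) auto
            then show ?thesis using True
              by (simp add: F_def mult_left_le)
          next
            case False
            then have "F \<tau> = 0"
              using T n by (auto simp: F_def pos_pow_eq_0)
            then show ?thesis by simp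
          qed
        qed
      qed simp
      have "((1 - t / T) / 2) ^ n * ((s - t) powr gam / gam)
          = (LINT \<tau>|lborel. ((1 - t / T) / 2) ^ n * (indicator {t..s} \<tau> * (\<tau> - t) powr (gam - 1)))"
        using shifted[of s] s by (simp add: has_bochner_integral_iff)
      also have "\<dots> \<le> (LINT \<tau>|lborel. F \<tau>)"
      proof (rule integral_mono)
        show "integrable lborel (\<lambda>\<tau>. ((1 - t / T) / 2) ^ n * (indicator {t..s} \<tau> * (\<tau> - t) powr (gam - 1)))"
          using shifted[of s] s by (simp add: has_bochner_integral_iff)
        show "((1 - t / T) / 2) ^ n * (indicator {t..s} \<tau> * (\<tau> - t) powr (gam - 1)) \<le> F \<tau>" for \<tau>
        proof (cases "t < \<tau> \<and> \<tau> \<le> s")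
          case True
          have "(1 - t / T) / 2 = 1 - s / T"
            using T by (simp add: s_def field_simps)
          also have "\<dots> \<le> 1 - \<tau> / T"
            using True T by (simp add: divide_right_mono)
          finally have "(1 - t / T) / 2 \<le> 1 - \<tau> / T" .
          moreover have "0 \<le> (1 - t / T) / 2"
            using \<open>t < T\<close> T by simp
          ultimately have "((1 - t / T) / 2) ^ n \<le> pos_pow n (1 - \<tau> / T)"
            unfolding pos_pow_def by (intro power_mono) auto
          then show ?thesis using True
            by (simp add: F_def mult_right_mono mult.commute)
        next
          case False
          then have "((1 - t / T) / 2) ^ n * (indicator {t..s} \<tau> * (\<tau> - t) powr (gam - 1)) = 0"
            by (cases "\<tau> = t") (auto simp: indicator_def)
          then show ?thesis using F0[of \<tau>] by linarith
        qed
      qed (rule FI)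
      finally have *: "((1 - t / T) / 2) ^ n * ((s - t) powr gam / gam) \<le> (LINT \<tau>|lborel. F \<tau>)" .
      have x0: "0 < 1 - t / T" using True T by simp
      have "s - t = (1 / 2) * (T * (1 - t / T))"
        using T by (simp add: s_def field_simps)
      then have "(s - t) powr gam = (1 / 2) powr gam * (T powr gam * (1 - t / T) powr gam)"
        using x0 T by (simp only: powr_mult)
      moreover have "max 0 (1 - t / T) powr (real n + gam) = (1 - t / T) ^ n * (1 - t / T) powr gam"
        using x0 by (simp add: powr_add powr_realpow max_def)
      ultimately have "c * T powr gam * max 0 (1 - t / T) powr (real n + gam)
         = 1 / Gamma gam * (((1 - t / T) / 2) ^ n * ((s - t) powr gam / gam))"
        by (simp add: c_def power_divide)
      also have "\<dots> \<le> 1 / Gamma gam * (LINT \<tau>|lborel. F \<tau>)"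
        using G0 by (intro mult_left_mono *) auto
      finally show ?thesis unfolding fi .
    qed
  qed
  with c0 show ?thesis by blast
qed

text \<open>The total mass of \<open>t^\<alpha> (1 - t/T)\<^sub>+^n\<close> has order \<open>T^(\<alpha>+1)\<close>; for the lower bound it
  suffices to integrate over \<open>(0, T/2]\<close>.\<close>

lemma time_weight_integral:
  assumes \<alpha>: "-1 < \<alpha>" and T: "0 < T" and n: "0 < n"
  shows "integrable lborel (\<lambda>t. indicator {0<..} t * t powr \<alpha> * pos_pow n (1 - t / T))" (is "integrable _ ?F")
    and "(1 / 2) ^ n * (T / 2) powr (\<alpha> + 1) / (\<alpha> + 1)
       \<le> (LINT t|lborel. indicator {0<..} t * t powr \<alpha> * pos_pow n (1 - t / T))"
proof -
  have b: "has_bochner_integral lborel (\<lambda>x. indicator {0..c} x * x powr \<alpha>) (c powr (\<alpha> + 1) / (\<alpha> + 1))"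
    if "0 \<le> c" for c
    by (rule has_bochner_integral_powr_from_0[OF \<alpha> that])
  have F0: "0 \<le> ?F t" for t by simp
  have [measurable]: "?F \<in> borel_measurable borel"
    unfolding pos_pow_def by measurable
  show i: "integrable lborel ?F"
  proof (rule Bochner_Integration.integrable_bound)
    show "integrable lborel (\<lambda>x. indicator {0..T} x * x powr \<alpha>)"
      using b[of T] T by (simp add: has_bochner_integral_iff)
    show "AE t in lborel. norm (?F t) \<le> norm (indicator {0..T} t * t powr \<alpha>)"
    proof (rule AE_I2)
      fix t
      show "norm (?F t) \<le> norm (indicator {0..T} t * t powr \<alpha>)"
      proof (cases "0 < t \<and> t \<le> T")
        case True
        then have "pos_pow n (1 - t / T) \<le> 1" using T by (intro pos_pow_le_one) auto
        then show ?thesis using True by (simp add: mult_left_le)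
      next
        case False
        then have "?F t = 0" using T n by (auto simp: pos_pow_eq_0)
        then show ?thesis by (simp only: norm_zero norm_ge_zero)
      qed
    qed
  qed simp
  have "(1 / 2) ^ n * (T / 2) powr (\<alpha> + 1) / (\<alpha> + 1)
      = (LINT t|lborel. (1 / 2) ^ n * (indicator {0..T / 2} t * t powr \<alpha>))"
    using b[of "T / 2"] T by (simp add: has_bochner_integral_iff)
  also have "\<dots> \<le> (LINT t|lborel. ?F t)"
  proof (rule integral_mono[OF _ i])
    show "integrable lborel (\<lambda>t. (1 / 2) ^ n * (indicator {0..T / 2} t * t powr \<alpha>))"
      using b[of "T / 2"] T by (simp add: has_bochner_integral_iff)
    show "(1 / 2) ^ n * (indicator {0..T / 2} t * t powr \<alpha>) \<le> ?F t" for t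
    proof (cases "0 < t \<and> t \<le> T / 2")
      case True
      then have "(1 / 2) \<le> 1 - t / T" using T by (simp add: field_simps)
      then have "(1 / 2) \<le> max 0 (1 - t / T)" by (rule max.coboundedI2)
      then have "(1 / 2) ^ n \<le> pos_pow n (1 - t / T)"
        unfolding pos_pow_def by (rule power_mono) simp
      then show ?thesis using True by (simp add: mult_right_mono mult.commute)
    next
      case False
      then have "(1 / 2) ^ n * (indicator {0..T / 2} t * t powr \<alpha>) = 0"
        by (cases "t = 0") (auto simp: indicator_def)
      then show ?thesis using F0[of t] by linarith
    qed
  qed
  finally show "(1 / 2) ^ n * (T / 2) powr (\<alpha> + 1) / (\<alpha> + 1) \<le> (LINT t|lborel. ?F t)" .
qed

lemma frac_int_mult_right:
  "frac_int gam T (\<lambda>s. a s * c) t = frac_int gam T a t * c"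
  by (simp add: frac_int_def interval_lebesgue_integral_def set_lebesgue_integral_def
      flip: mult.assoc)

section \<open>Products as test functions\<close>

lemma pderiv_dir_zero_outside:
  fixes g :: "'a::euclidean_space \<Rightarrow> real"
  assumes "closed K" "\<And>z. z \<notin> K \<Longrightarrow> g z = 0" "z \<notin> K"
  shows "pderiv_dir e g z = 0"
proof (rule pderiv_dir_eqI)
  have o: "open ((\<lambda>s. z + s *\<^sub>R e) -` (- K))"
    using assms(1) by (intro open_vimage continuous_intros) auto
  show "((\<lambda>s. g (z + s *\<^sub>R e)) has_real_derivative 0) (at 0)"
    by (rule has_field_derivative_transform_within_open[OF DERIV_const[of 0] o])
       (use assms in auto)
qed

lemma compact_support_bounded:
  fixes g :: "'a::euclidean_space \<Rightarrow> real"
  assumes "continuous_on UNIV g" "compact K" "\<And>z. z \<notin> K \<Longrightarrow> g z = 0"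
  obtains M where "M > 0" "\<And>z. \<bar>g z\<bar> \<le> M"
proof -
  have "bounded (g ` K)"
    using assms by (intro compact_imp_bounded compact_continuous_image)
      (auto intro: continuous_on_subset)
  then obtain M where "M > 0" and M: "\<And>z. z \<in> K \<Longrightarrow> \<bar>g z\<bar> \<le> M"
    by (auto simp: bounded_pos)
  moreover have "\<bar>g z\<bar> \<le> M" for z
    using M[of z] assms(3)[of z] \<open>M > 0\<close> by (cases "z \<in> K") auto
  ultimately show ?thesis using that by blast
qed

lemma uniform_limit_scalar_mult:
  fixes g :: "'a::euclidean_space \<Rightarrow> real"
  assumes c: "(c \<longlongrightarrow> c0) F"
    and g: "continuous_on UNIV g" "compact K" "\<And>z. z \<notin> K \<Longrightarrow> g z = 0"
  shows "uniform_limit UNIV (\<lambda>s z. c s * g z) (\<lambda>z. c0 * g z) F"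
proof (rule uniform_limitI)
  fix \<epsilon> :: real assume "\<epsilon> > 0"
  obtain M where M: "M > 0" "\<And>z. \<bar>g z\<bar> \<le> M"
    using compact_support_bounded[OF g] by blast
  have "\<forall>\<^sub>F s in F. dist (c s) c0 < \<epsilon> / M"
    using c \<open>\<epsilon> > 0\<close> M(1) by (intro tendstoD) auto
  then show "\<forall>\<^sub>F s in F. \<forall>z\<in>UNIV. dist (c s * g z) (c0 * g z) < \<epsilon>"
  proof eventually_elim
    case (elim s)
    show ?case
    proof
      fix z
      have "dist (c s * g z) (c0 * g z) = \<bar>c s - c0\<bar> * \<bar>g z\<bar>"
        by (simp add: dist_real_def abs_mult flip: left_diff_distrib)
      also have "\<dots> \<le> \<bar>c s - c0\<bar> * M"
        by (intro mult_left_mono M) auto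
      also have "\<dots> < \<epsilon>"
        using elim M(1) by (simp add: dist_real_def field_simps)
      finally show "dist (c s * g z) (c0 * g z) < \<epsilon>" .
    qed
  qed
qed

lemma pderiv_dir_cmult:
  assumes "C1_fun g" "e \<in> Basis"
  shows "pderiv_dir e (\<lambda>z. c * g z) = (\<lambda>z. c * pderiv_dir e g z)"
  using assms unfolding C1_fun_def pderiv_dir_def by (intro ext deriv_cmult) auto

lemma C1_fun_cmult: "C1_fun g \<Longrightarrow> C1_fun (\<lambda>z. c * g z)"
  using pderiv_dir_cmult[of g]
  unfolding C1_fun_def
  by (auto intro!: continuous_intros derivative_intros)

lemma C2_fun_cmult: "C2_fun g \<Longrightarrow> C2_fun (\<lambda>z. c * g z)"
  unfolding C2_fun_def by (auto simp: pderiv_dir_cmult intro: C1_fun_cmult)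

lemma C2_tendsto_scalar_mult:
  fixes g :: "'a::euclidean_space \<Rightarrow> real"
  assumes c: "(c \<longlongrightarrow> c0) F" and g: "C2_fun g"
    and K: "compact K" "\<And>z. z \<notin> K \<Longrightarrow> g z = 0"
  shows "C2_tendsto (\<lambda>s z. c s * g z) (\<lambda>z. c0 * g z) F"
proof -
  have cl: "closed K" using K by (simp add: compact_imp_closed)
  have C1: "C1_fun g" "\<And>e. e \<in> Basis \<Longrightarrow> C1_fun (pderiv_dir e g)"
    using g by (auto simp: C2_fun_def)
  have 1: "pderiv_dir e g z = 0" if "z \<notin> K" for e z
    by (rule pderiv_dir_zero_outside[OF cl K(2) that])
  have 2: "pderiv_dir d (pderiv_dir e g) z = 0" if "z \<notin> K" for d e z
    by (rule pderiv_dir_zero_outside[OF cl 1 that])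
  show ?thesis
    unfolding C2_tendsto_def
    using C1 K 1 2
    by (auto simp: pderiv_dir_cmult C1_fun_def intro!: uniform_limit_scalar_mult[OF c, of _ K])
qed

text \<open>Derivatives of the \<open>C\<^sup>2\<close>-valued curve \<open>t \<mapsto> a(t) b\<close> reduce to derivatives of \<open>a\<close>, because \<open>b\<close> and its
  derivatives are bounded.\<close>

lemma test_function_product:
  fixes b :: "'a::euclidean_space \<Rightarrow> real"
  assumes a: "\<And>t. (a has_real_derivative a' t) (at t)" "continuous_on UNIV a'"
    and a0: "\<And>t. t \<ge> T \<Longrightarrow> a t = 0"
    and b: "C2_fun b" and K: "compact K" "\<And>z. z \<notin> K \<Longrightarrow> b z = 0"
  shows "test_function \<infinity> (\<lambda>t z. a t * b z)"
proof -
  have I: "{t. 0 \<le> t \<and> ereal t < \<infinity>} = {0::real..}" by auto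
  have supp: "\<exists>J K. compact J \<and> J \<subseteq> {0..} \<and> compact K \<and>
        (\<forall>t\<in>{0..}. \<forall>z. a t * b z \<noteq> 0 \<longrightarrow> t \<in> J \<and> z \<in> K)"
    using K a0 by (intro exI[of _ "{0..T}"] exI[of _ K]) (auto simp: not_le[symmetric] intro: ccontr)
  have d: "C2_tendsto (\<lambda>s z. (a s * b z - a t * b z) / (s - t)) (\<lambda>z. a' t * b z) (at t within {0..})" for t
  proof -
    have "((\<lambda>s. (a s - a t) / (s - t)) \<longlongrightarrow> a' t) (at t within {0..})"
      using has_field_derivative_at_within[OF a(1)] by (simp add: has_field_derivative_iff)
    from C2_tendsto_scalar_mult[OF this b K] show ?thesis
      by (simp add: left_diff_distrib)
  qed
  have c: "C2_tendsto (\<lambda>s z. a' s * b z) (\<lambda>z. a' t * b z) (at t within {0..})" for t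
    using a(2) by (intro C2_tendsto_scalar_mult[OF _ b K])
      (auto simp: continuous_on_def intro: tendsto_within_subset)
  show ?thesis
    unfolding test_function_def Let_def I
    using supp d c C2_fun_cmult[OF b] by (intro conjI exI[of _ "\<lambda>t z. a' t * b z"]) auto
qed

section \<open>The nonlinear capacity estimate\<close>

text \<open>Young's inequality in the form that the capacity argument needs, without the optimal constants. If
  \<open>K \<le> k Y^(p-1)\<close>, the first term on the right dominates; otherwise \<open>Y < (K/k)^(1/(p-1))\<close>, and the second
  one does.\<close>

lemma young_weighted:
  fixes p :: real
  assumes p: "1 < p" and "0 \<le> Y" "0 < K" "0 < k"
  shows "Y * K \<le> k * Y powr p + K powr (p / (p - 1)) * k powr (- 1 / (p - 1))"
proof (cases "Y = 0 \<or> K \<le> k * Y powr (p - 1)")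
  case True
  then show ?thesis
  proof
    assume "K \<le> k * Y powr (p - 1)"
    then have "Y * K \<le> Y * (k * Y powr (p - 1))"
      using \<open>0 \<le> Y\<close> by (rule mult_left_mono)
    also have "\<dots> = k * Y powr p"
    proof (cases "Y = 0")
      case False
      then have "Y powr p = Y powr 1 * Y powr (p - 1)"
        by (simp only: powr_add[symmetric]) simp
      then show ?thesis using False \<open>0 \<le> Y\<close> by simp
    qed simp
    finally show ?thesis
      by (rule order_trans) simp
  qed simp
next
  case False
  then have Y: "0 < Y" and "Y powr (p - 1) < K / k"
    using assms by (auto simp: field_simps)
  then have "(Y powr (p - 1)) powr (1 / (p - 1)) \<le> (K / k) powr (1 / (p - 1))"
    using p by (intro powr_mono2) auto
  then have "Y \<le> (K / k) powr (1 / (p - 1))"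
    using p Y by (simp add: powr_powr)
  then have "Y * K \<le> (K / k) powr (1 / (p - 1)) * K"
    using assms by (intro mult_right_mono) auto
  also have "\<dots> = K powr (p / (p - 1)) * k powr (- 1 / (p - 1))"
  proof -
    have "p / (p - 1) = 1 / (p - 1) + 1" using p by (simp add: field_simps)
    then have "K powr (p / (p - 1)) = K powr (1 / (p - 1)) * K"
      using \<open>0 < K\<close> by (simp only: powr_add) simp
    then show ?thesis
      using assms by (simp add: powr_divide powr_minus_divide)
  qed
  finally show ?thesis using assms
    by (smt (verit) mult_nonneg_nonneg powr_ge_zero)
qed

lemma hardy_mu_bounds:
  assumes "0 < lam" "lam < ((hom_dim TYPE('n::finite) - 2) / 2)\<^sup>2"
  shows "0 < hardy_mu TYPE('n) lam" "hardy_mu TYPE('n) lam < real CARD('n)"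
proof -
  have e: "(hom_dim TYPE('n) - 2) / 2 = real CARD('n)" by (simp add: hom_dim_def)
  have "sqrt ((real CARD('n))\<^sup>2 - lam) < sqrt ((real CARD('n))\<^sup>2)"
    using assms by (intro real_sqrt_less_mono) simp
  then show "0 < hardy_mu TYPE('n) lam"
    unfolding hardy_mu_def e by simp
  show "hardy_mu TYPE('n) lam < real CARD('n)"
    unfolding hardy_mu_def e using assms(2) unfolding e by simp
qed

text \<open>The part of the argument that only uses integration. Let \<open>A\<close> and \<open>B\<close> be the integrands of the linear
  and the nonlinear term. If \<open>-A - B\<close> is bounded pointwise by an integrable function \<open>w\<close> on the time slab
  \<open>(0, T)\<close>, then the weak identity bounds the source term by the initial term and by \<open>T \<integral> w\<close>. The source term
  factors into a time and a space integral.\<close>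

lemma test_function_inequality:
  fixes u0 f :: "'n::finite heis \<Rightarrow> real"
  assumes sol: "global_weak_solution lam gam \<alpha> p f u0 u"
    and m: "m = hardy_mu TYPE('n) lam"
    and \<phi>: "test_function \<infinity> (\<lambda>t z. a t * b z)" "\<And>t z. 0 \<le> t \<Longrightarrow> 0 \<le> a t * b z"
    and a0: "a 0 = 1" and b: "\<And>z. 0 \<le> b z \<and> b z \<le> 1" "b \<in> borel_measurable borel"
    and u0: "integrable lebesgue (\<lambda>z. koranyi z powr (- m) * u0 z)"
    and f: "integrable lebesgue (\<lambda>z. koranyi z powr (- m) * f z)"
    and J: "integrable lborel (\<lambda>t. indicator {0<..} t * t powr \<alpha> * a t)"
    and w: "w \<in> borel_measurable borel" "\<And>z. 0 \<le> w z" "(\<integral>\<^sup>+z. ennreal (w z) \<partial>lborel) \<le> ennreal W"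
      "0 \<le> W" "0 < T"
    and G: "\<And>t z. 0 < t \<Longrightarrow>
       - (koranyi z powr m * u t z * (koranyi z powr (- 2 * m) * (deriv a t * b z)
            - L_H m (\<lambda>z. a t * b z) z))
       - koranyi z powr (- (p + 1) * m) * \<bar>koranyi z powr m * u t z\<bar> powr p
            * (frac_int gam \<infinity> a t * b z)
       \<le> indicator {0<..<T} t * w z"
    and da: "\<And>t. (a has_real_derivative deriv a t) (at t)"
  shows "(LINT t|lborel. indicator {0<..} t * t powr \<alpha> * a t)
            * (LINT z|lebesgue. koranyi z powr (- m) * f z * b z)
         \<le> (LINT z|lebesgue. \<bar>koranyi z powr (- m) * u0 z\<bar>) + T * W"
proof -
  define X where "X = (indicator (einterval 0 \<infinity> \<times> UNIV) :: real \<times> 'n heis \<Rightarrow> real)"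
  have X: "X (t, z) = indicator {0<..} t" for t z
    by (auto simp: X_def indicator_def einterval_def)
  define v where "v = (\<lambda>t z. koranyi z powr m * u t z)"
  define A where "A = (\<lambda>t z. v t z * (koranyi z powr (- 2 * m) * (deriv a t * b z)
            - L_H m (\<lambda>z. a t * b z) z))"
  define B where "B = (\<lambda>t z. koranyi z powr (- (p + 1) * m) * \<bar>v t z\<bar> powr p
            * (frac_int gam \<infinity> a t * b z))"
  define C where "C = (\<lambda>z. koranyi z powr (- 2 * m) * (koranyi z powr m * u0 z) * (a 0 * b z))"
  define D where "D = (\<lambda>t z. koranyi z powr (- m) * t powr \<alpha> * f z * (a t * b z))"
  have dv: "deriv (\<lambda>s. a s * b z) t = deriv a t * b z" for t z
    by (rule DERIV_imp_deriv[OF DERIV_cmult_right[OF da]])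
  have id: "st_integrable \<infinity> A" "st_integrable \<infinity> B" "integrable lebesgue C" "st_integrable \<infinity> D"
      "- st_integral \<infinity> A = st_integral \<infinity> B + integral\<^sup>L lebesgue C + st_integral \<infinity> D"
    using sol[unfolded global_weak_solution_def weak_solution_def Let_def, folded m] \<phi>
    unfolding A_def B_def C_def D_def v_def
    by (auto simp: dv frac_int_mult_right)
  define g where "g = (\<lambda>(t, z). indicator {0<..<T::real} t * w z)"
  have gm: "g \<in> borel_measurable (lborel :: (real \<times> 'n heis) measure)"
    unfolding g_def by (rule borel_measurable_time_slab[OF w(1)])
  have gm': "g \<in> borel_measurable lebesgue"
    using gm by (rule measurable_completion)
  have g0: "0 \<le> g x" for x
    using w(2) by (auto simp: g_def split: prod.splits)
  have "(\<integral>\<^sup>+x. ennreal (g x) \<partial>lebesgue) = (\<integral>\<^sup>+(t, z). indicator {0<..<T} t * ennreal (w z) \<partial>(lborel :: (real \<times> 'n heis) measure))"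
    unfolding nn_integral_completion
    by (intro nn_integral_cong) (auto simp: g_def indicator_def split: prod.splits)
  also have "\<dots> = ennreal T * (\<integral>\<^sup>+z. ennreal (w z) \<partial>lborel)"
    using w(1,5) by (intro nn_integral_time_slab) auto
  also have "\<dots> \<le> ennreal T * ennreal W"
    by (intro mult_left_mono w) auto
  also have "\<dots> = ennreal (T * W)"
    using w by (simp add: ennreal_mult)
  finally have gle: "(\<integral>\<^sup>+x. ennreal (g x) \<partial>lebesgue) \<le> ennreal (T * W)" .
  have gi: "integrable lebesgue g"
    using gm' g0 le_less_trans[OF gle] by (intro integrableI_nonneg) auto
  have gI: "integral\<^sup>L lebesgue g \<le> T * W"
  proof -
    have "ennreal (integral\<^sup>L lebesgue g) \<le> ennreal (T * W)"
      using gle g0 by (subst nn_integral_eq_integral[OF gi, symmetric]) auto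
    then show ?thesis using w by (subst (asm) ennreal_le_iff) auto
  qed
  have XA: "integrable lebesgue (\<lambda>x. X x * (case x of (t, z) \<Rightarrow> A t z))"
    and XB: "integrable lebesgue (\<lambda>x. X x * (case x of (t, z) \<Rightarrow> B t z))"
    and XD: "integrable lebesgue (\<lambda>x. X x * (case x of (t, z) \<Rightarrow> D t z))"
    using id(1,2,4) by (simp_all add: st_integrable_def set_integrable_def X_def)
  have "(LINT x|lebesgue. - (X x * (case x of (t, z) \<Rightarrow> A t z)) - X x * (case x of (t, z) \<Rightarrow> B t z))
      \<le> integral\<^sup>L lebesgue g"
  proof (intro integral_mono Bochner_Integration.integrable_diff integrable_minus XA XB gi)
    fix x :: "real \<times> 'n heis"
    obtain t z where x: "x = (t, z)" by (cases x)
    show "- (X x * (case x of (t, z) \<Rightarrow> A t z)) - X x * (case x of (t, z) \<Rightarrow> B t z) \<le> g x"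
    proof (cases "0 < t")
      case True
      then show ?thesis
        using G[OF True, of z] by (simp add: x X g_def A_def B_def v_def)
    next
      case False
      then show ?thesis using g0[of x] by (simp add: x X)
    qed
  qed
  then have AB: "- st_integral \<infinity> A - st_integral \<infinity> B \<le> T * W"
    using gI XA XB by (simp add: st_integral_def set_lebesgue_integral_def X_def[symmetric])
  have "(\<lambda>z. koranyi z powr (- 2 * m) * koranyi z powr m) = (\<lambda>z::'n heis. koranyi z powr (- m))"
    by (simp add: powr_add[symmetric])
  then have C': "C z = (koranyi z powr (- m) * u0 z) * b z" for z
    unfolding C_def a0 by (metis (no_types, lifting) mult.assoc mult_1)
  have "- integral\<^sup>L lebesgue C \<le> (LINT z|lebesgue. \<bar>C z\<bar>)"
    using integral_abs_bound[of lebesgue C] by linarith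
  also have "\<dots> \<le> (LINT z|lebesgue. \<bar>koranyi z powr (- m) * u0 z\<bar>)"
    using id(3) u0 b(1) unfolding C'
    by (intro integral_mono integrable_abs) (auto simp: abs_mult mult_left_le C')
  finally have Cle: "- integral\<^sup>L lebesgue C \<le> (LINT z|lebesgue. \<bar>koranyi z powr (- m) * u0 z\<bar>)" .
  have bl: "b \<in> borel_measurable lebesgue"
    using b(2) by (intro measurable_completion) simp
  have fb: "integrable lebesgue (\<lambda>z. koranyi z powr (- m) * f z * b z)"
  proof (rule Bochner_Integration.integrable_bound[OF f])
    show "(\<lambda>z. koranyi z powr (- m) * f z * b z) \<in> borel_measurable lebesgue"
      using borel_measurable_integrable[OF f] bl by (rule borel_measurable_times)
    show "AE z in lebesgue. norm (koranyi z powr (- m) * f z * b z) \<le> norm (koranyi z powr (- m) * f z)"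
      using b(1) by (intro AE_I2) (simp add: abs_mult mult_left_le)
  qed
  have XDeq: "X x * (case x of (t, z) \<Rightarrow> D t z) = (case x of (t, z) \<Rightarrow>
      (indicator {0<..} t * t powr \<alpha> * a t) * (koranyi z powr (- m) * f z * b z))" for x
    by (cases x) (simp add: X D_def)
  have "st_integral \<infinity> D = (LINT t|lborel. indicator {0<..} t * t powr \<alpha> * a t)
            * (LINT z|lebesgue. koranyi z powr (- m) * f z * b z)"
    using integral_product_completion[OF J fb] borel_measurable_integrable[OF XD]
    unfolding XDeq by (simp add: st_integral_def set_lebesgue_integral_def X_def[symmetric] XDeq)
  then show ?thesis using AB Cle id(5) by linarith
qed

text \<open>The function \<open>h\<close> is the cut-off of \<open>ex_smooth_cutoff\<close>. The factor \<open>J\<close> is the mass of \<open>t^\<alpha> a(t)\<close>, which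
  has only a lower bound here; it is kept as a variable since the sign of the integral that it multiplies is known
  only for large \<open>R\<close>.\<close>

lemma testing_estimate:
  fixes u0 f :: "'n::finite heis \<Rightarrow> real" and h :: "real \<Rightarrow> real"
  assumes sol: "global_weak_solution lam gam \<alpha> p f u0 u"
    and m: "m = hardy_mu TYPE('n) lam" "0 \<le> m" "m < 2 * real CARD('n) + 2"
    and gam: "0 \<le> gam" "gam < 1" and \<alpha>: "-1 < \<alpha>" and p: "1 < p"
    and u0: "integrable lebesgue (\<lambda>z. koranyi z powr (- m) * u0 z)"
    and f: "integrable lebesgue (\<lambda>z. koranyi z powr (- m) * f z)"
    and h: "\<And>s. (h has_real_derivative h' s) (at s)" "\<And>s. (h' has_real_derivative h'' s) (at s)"
      "continuous_on UNIV h''" "\<And>s. 0 \<le> h s \<and> h s \<le> 1"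
    and h0: "\<And>s. s \<le> 1 \<Longrightarrow> h' s = 0" "\<And>s. s \<ge> 2 \<Longrightarrow> h s = 0"
    and C: "0 < C" "\<And>s. \<bar>h' s\<bar> \<le> C * h s powr (1 / p)" "\<And>s. \<bar>h'' s\<bar> \<le> C * h s powr (1 / p)"
  shows "\<exists>c>0. \<exists>K. \<forall>R>0. \<exists>J \<ge> c * R powr (2 * (\<alpha> + 1)).
      J * (LINT z|lebesgue. koranyi z powr (- m) * f z * h (koranyi4 z / R ^ 4))
       \<le> (LINT z|lebesgue. \<bar>koranyi z powr (- m) * u0 z\<bar>)
         + K * R powr (2 * real CARD('n) + 4 - m - 2 * (p + gam) / (p - 1))"
proof -
  define d where "d = 2 * real CARD('n) + 2"
  obtain n0 :: nat where n0: "(p + 1) / (p - 1) < real n0"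
    using reals_Archimedean2 by blast
  \<comment> \<open>The choice of \<open>n\<close> makes \<open>e = (1 - t/T)\<^sub>+^(n-1)\<close>, which controls both \<open>a\<close> and \<open>R\<^sup>2 |a'|\<close>, satisfy
    \<open>e^p \<le> (1 - t/T)\<^sub>+^(n+\<gamma>)\<close>.\<close>
  define n where "n = n0 + 2"
  have "(p + 1) / (p - 1) \<le> real n" using n0 by (simp add: n_def)
  then have "p + 1 \<le> real n * (p - 1)" using p by (simp add: field_simps)
  then have np: "real n + gam \<le> (real n - 1) * p" using gam by (simp add: algebra_simps)
  have n2: "2 \<le> n" by (simp add: n_def)
  obtain c\<gamma> where c\<gamma>: "0 < c\<gamma>" "\<And>T t. 0 < T \<Longrightarrow> 0 \<le> t \<Longrightarrow> c\<gamma> * T powr gam * max 0 (1 - t / T) powr (real n + gam)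
           \<le> frac_int gam \<infinity> (\<lambda>\<tau>. pos_pow n (1 - \<tau> / T)) t"
    using frac_int_pos_pow_ge[OF gam, of n] n2 by auto
  obtain Kw where Kw: "0 \<le> Kw" "\<And>\<rho>. 0 < \<rho> \<Longrightarrow>
    (\<integral>\<^sup>+(z::'n heis). ennreal (koranyi4 z powr (- m / 4)) * indicator {z. koranyi4 z \<le> \<rho> ^ 4} z \<partial>lborel)
      \<le> ennreal (Kw * \<rho> powr (d - m))"
    using nn_integral_koranyi4_weight_le[where 'n='n, OF m(2,3)] unfolding d_def by blast
  define CL where "CL = 2 * (32 + \<bar>16 + 8 * real CARD('n) - 8 * m\<bar>) * C"
  have CL0: "0 < CL" unfolding CL_def by (intro mult_pos_pos add_pos_nonneg C) auto
  define K where "K = real n + CL"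
  have K0: "0 < K" using CL0 by (simp add: K_def)
  \<comment> \<open>The coefficient of the remainder in Young's inequality, for the linear term of size \<open>K/R\<^sup>2\<close> and the
    nonlinear term of size \<open>c\<gamma> T^\<gamma>\<close>, \<open>T = R\<^sup>2\<close>.\<close>
  define E where "E = (\<lambda>R. (K / R\<^sup>2) powr (p / (p - 1)) * (c\<gamma> * R\<^sup>2 powr gam) powr (- 1 / (p - 1)))"
  define c where "c = (1 / 2) ^ n * (1 / 2) powr (\<alpha> + 1) / (\<alpha> + 1)"
  have c0: "0 < c" using \<alpha> by (simp add: c_def)
  define KK where "KK = K powr (p / (p - 1)) * c\<gamma> powr (- 1 / (p - 1)) * Kw * 2 powr (d - m)"
  have "\<exists>J \<ge> c * R powr (2 * (\<alpha> + 1)).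
      J * (LINT z|lebesgue. koranyi z powr (- m) * f z * h (koranyi4 z / R ^ 4))
       \<le> (LINT z|lebesgue. \<bar>koranyi z powr (- m) * u0 z\<bar>)
         + KK * R powr (d + 2 - m - 2 * (p + gam) / (p - 1))" if R: "0 < R" for R
  proof -
    define T where "T = R\<^sup>2"
    have T: "0 < T" using R by (simp add: T_def)
    have R4: "0 < R ^ 4" using R by simp
    define a where "a = (\<lambda>t. pos_pow n (1 - t / T))"
    define a' where "a' = (\<lambda>t. real n * pos_pow (n - 1) (1 - t / T) * (- 1 / T))"
    define b where "b = (\<lambda>z::'n heis. h (koranyi4 z / R ^ 4))"
    have da: "(a has_real_derivative a' t) (at t)" for t
      unfolding a_def a'_def using n2 T by (auto intro!: derivative_eq_intros)
    have deriv_a: "deriv a t = a' t" for t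
      by (rule DERIV_imp_deriv[OF da])
    have b01: "0 \<le> b z \<and> b z \<le> 1" for z unfolding b_def by (rule h)
    have dscale: "((\<lambda>s. s / R ^ 4) has_real_derivative 1 / R ^ 4) (at s)" for s
      by (rule DERIV_cdivide[OF DERIV_ident])
    have C2b: "C2_fun b"
      unfolding b_def
    proof (rule C2_fun_radial)
      show "((\<lambda>s. h (s / R ^ 4)) has_real_derivative h' (s / R ^ 4) * (1 / R ^ 4)) (at s)" for s
        by (rule DERIV_chain2[OF h(1) dscale])
      show "((\<lambda>s. h' (s / R ^ 4) * (1 / R ^ 4)) has_real_derivative
          h'' (s / R ^ 4) * (1 / R ^ 4) * (1 / R ^ 4)) (at s)" for s
        by (rule DERIV_cmult_right[OF DERIV_chain2[OF h(2) dscale]])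
      show "continuous_on UNIV (\<lambda>s. h'' (s / R ^ 4) * (1 / R ^ 4) * (1 / R ^ 4))"
        using R by (intro continuous_intros continuous_on_compose2[OF h(3)]) auto
    qed
    have bm: "b \<in> borel_measurable borel"
      using C2b by (intro borel_measurable_continuous_onI) (simp add: C2_fun_def C1_fun_def)
    have b_out: "b z = 0" if "\<not> koranyi4 z \<le> 2 * R ^ 4" for z
      unfolding b_def using that R4 by (intro h0) (simp add: field_simps)
    have test: "test_function \<infinity> (\<lambda>t z. a t * b z)"
    proof (rule test_function_product[OF da _ _ C2b compact_koranyi4_sublevel])
      show "continuous_on UNIV a'" unfolding a'_def using T by (intro continuous_intros) auto
      show "a t = 0" if "T \<le> t" for t
        using that T n2 by (simp add: a_def pos_pow_eq_0)
      show "b z = 0" if "z \<notin> {z. koranyi4 z \<le> 2 * R ^ 4}" for z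
        using b_out that by simp
    qed
    \<comment> \<open>The support \<open>P \<le> 2 R^4\<close> of \<open>b\<close> lies in the ball of radius \<open>2R\<close>.\<close>
    define w where "w = (\<lambda>z::'n heis. E R * (koranyi4 z powr (- m / 4) * indicator {z. koranyi4 z \<le> (2 * R) ^ 4} z))"
    have E0: "0 \<le> E R" by (simp add: E_def)
    have wm: "w \<in> borel_measurable borel" unfolding w_def by measurable
    have w0: "0 \<le> w z" for z using E0 by (simp add: w_def)
    have wI: "(\<integral>\<^sup>+z. ennreal (w z) \<partial>lborel) \<le> ennreal (E R * (Kw * (2 * R) powr (d - m)))"
    proof -
      have "(\<integral>\<^sup>+z. ennreal (w z) \<partial>lborel)
          = (\<integral>\<^sup>+(z::'n heis). ennreal (E R) * (ennreal (koranyi4 z powr (- m / 4)) * indicator {z. koranyi4 z \<le> (2 * R) ^ 4} z) \<partial>lborel)"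
        unfolding w_def by (intro nn_integral_cong) (simp add: ennreal_mult E0 indicator_def)
      also have "\<dots> = ennreal (E R) * (\<integral>\<^sup>+(z::'n heis). ennreal (koranyi4 z powr (- m / 4)) * indicator {z. koranyi4 z \<le> (2 * R) ^ 4} z \<partial>lborel)"
        by (intro nn_integral_cmult) measurable
      also have "\<dots> \<le> ennreal (E R) * ennreal (Kw * (2 * R) powr (d - m))"
        using R by (intro mult_left_mono Kw) auto
      also have "\<dots> = ennreal (E R * (Kw * (2 * R) powr (d - m)))"
        using Kw by (simp add: ennreal_mult E0)
      finally show ?thesis .
    qed
    have W0: "0 \<le> E R * (Kw * (2 * R) powr (d - m))" using E0 Kw by simp
    have G: "- (koranyi z powr m * u t z * (koranyi z powr (- 2 * m) * (deriv a t * b z)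
            - L_H m (\<lambda>z. a t * b z) z))
       - koranyi z powr (- (p + 1) * m) * \<bar>koranyi z powr m * u t z\<bar> powr p
            * (frac_int gam \<infinity> a t * b z)
       \<le> indicator {0<..<T} t * w z" if t: "0 < t" for t z
    proof -
      define r where "r = koranyi z"
      define V where "V = \<bar>r powr m * u t z\<bar>"
      define s where "s = max 0 (1 - t / T)"
      define e where "e = s ^ (n - 1)"
      \<comment> \<open>Up to constants, \<open>Z\<close> bounds the derivatives of the test function and \<open>Z^p\<close> bounds its fractional
        integral from below.\<close>
      define Z where "Z = e * b z powr (1 / p)"
      have s01: "0 \<le> s" "s \<le> 1" using t T by (auto simp: s_def)
      have e0: "0 \<le> e" using s01 by (simp add: e_def)
      have Z0: "0 \<le> Z" using e0 by (simp add: Z_def)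
      have bb: "b z \<le> b z powr (1 / p)"
        using b01[of z] p powr_mono'[of "1 / p" 1 "b z"] by (cases "b z = 0") auto
      have bp: "(b z powr (1 / p)) powr p = b z"
        using b01[of z] p by (simp add: powr_powr)
      have ae: "a t \<le> e" "0 \<le> a t"
        unfolding a_def e_def pos_pow_def s_def[symmetric] using s01 by (auto intro: power_decreasing)
      have a'e: "\<bar>a' t\<bar> = real n / R\<^sup>2 * e"
        using T e0 unfolding a'_def pos_pow_def s_def[symmetric] e_def[symmetric]
        by (simp add: abs_mult T_def)
      define A where "A = r powr m * u t z * (r powr (- 2 * m) * (deriv a t * b z)
            - L_H m (\<lambda>z. a t * b z) z)"
      define B where "B = r powr (- (p + 1) * m) * V powr p * (frac_int gam \<infinity> a t * b z)"
      have LH: "\<bar>L_H m (\<lambda>z. a t * b z) z\<bar> \<le> a t * (CL / R\<^sup>2 * r powr (- 2 * m) * b z powr (1 / p))"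
        using L_H_cutoff_bound[OF h(1,2) h0 C R, of m "a t" z] ae
        unfolding b_def r_def CL_def by simp
      also have "\<dots> \<le> CL / R\<^sup>2 * r powr (- 2 * m) * Z"
        using ae(1) CL0 unfolding Z_def
        by (simp add: mult_right_mono mult_ac divide_right_mono)
      finally have 1: "\<bar>L_H m (\<lambda>z. a t * b z) z\<bar> \<le> CL / R\<^sup>2 * r powr (- 2 * m) * Z" .
      have "\<bar>r powr (- 2 * m) * (deriv a t * b z)\<bar> = r powr (- 2 * m) * (real n / R\<^sup>2 * e * b z)"
        using b01[of z] by (simp add: deriv_a abs_mult a'e)
      also have "\<dots> \<le> r powr (- 2 * m) * (real n / R\<^sup>2 * e * b z powr (1 / p))"
        using bb e0 by (intro mult_left_mono) auto
      finally have 2: "\<bar>r powr (- 2 * m) * (deriv a t * b z)\<bar> \<le> real n / R\<^sup>2 * r powr (- 2 * m) * Z"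
        by (simp add: Z_def mult_ac)
      have "\<bar>A\<bar> \<le> V * (real n / R\<^sup>2 * r powr (- 2 * m) * Z + CL / R\<^sup>2 * r powr (- 2 * m) * Z)"
        unfolding A_def abs_mult[of "r powr m * u t z"] V_def
        using 1 2 by (intro mult_left_mono) auto
      also have "\<dots> = V * r powr (- 2 * m) * Z * (K / R\<^sup>2)"
        by (simp add: K_def algebra_simps add_divide_distrib)
      finally have Ale: "\<bar>A\<bar> \<le> V * r powr (- 2 * m) * Z * (K / R\<^sup>2)" .
      have Zp: "Z powr p \<le> s powr (real n + gam) * b z"
      proof (cases "s = 0")
        case True
        then show ?thesis using n2 by (simp add: Z_def e_def)
      next
        case False
        then have sp: "0 < s" using s01 by simp
        have "e powr p = s powr ((real n - 1) * p)"
          using sp n2 by (simp add: e_def powr_realpow[symmetric] powr_powr of_nat_diff)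
        also have "\<dots> \<le> s powr (real n + gam)"
          using sp s01 np by (intro powr_mono') auto
        finally have "e powr p * b z \<le> s powr (real n + gam) * b z"
          using b01[of z] by (intro mult_right_mono) auto
        then show ?thesis
          using e0 by (simp add: Z_def powr_mult bp)
      qed
      have Bge: "r powr (- (p + 1) * m) * V powr p * (c\<gamma> * R\<^sup>2 powr gam * Z powr p) \<le> B"
        unfolding B_def
      proof (intro mult_left_mono)
        have "c\<gamma> * R\<^sup>2 powr gam * Z powr p \<le> c\<gamma> * R\<^sup>2 powr gam * (s powr (real n + gam) * b z)"
          using c\<gamma>(1) by (intro mult_left_mono Zp) auto
        also have "\<dots> \<le> frac_int gam \<infinity> a t * b z"
          using c\<gamma>(2)[of T t] T t b01[of z]
          unfolding mult.assoc[symmetric] a_def s_def T_def by (intro mult_right_mono) auto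
        finally show "c\<gamma> * R\<^sup>2 powr gam * Z powr p \<le> frac_int gam \<infinity> a t * b z" .
      qed auto
      have k0: "0 < c\<gamma> * R\<^sup>2 powr gam" using c\<gamma> R by simp
      have KR: "0 < K / R\<^sup>2" using K0 R by simp
      have key: "\<bar>A\<bar> \<le> B + indicator {0<..<T} t * w z"
      proof (cases "r = 0 \<or> Z = 0")
        case True
        \<comment> \<open>At the origin all weights are \<open>0\<close>, because \<open>0 powr a = 0\<close>.\<close>
        then have "\<bar>A\<bar> \<le> 0" using Ale by auto
        moreover have "0 \<le> B"
          by (rule order_trans[OF _ Bge]) (use c\<gamma>(1) in simp)
        moreover have "0 \<le> indicator {0<..<T} t * w z" using w0 by simp
        ultimately show ?thesis by linarith
      next
        case False
        have r0: "0 < r" using False koranyi_eq_koranyi4[of z] by (simp add: r_def)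
        have tT: "t < T"
          using False T n2 by (cases "t < T") (auto simp: Z_def e_def s_def)
        have zin: "koranyi4 z \<le> (2 * R) ^ 4"
        proof -
          have "koranyi4 z \<le> 2 * R ^ 4"
            using False b_out[of z] by (cases "koranyi4 z \<le> 2 * R ^ 4") (auto simp: Z_def)
          also have "\<dots> \<le> (2 * R) ^ 4" using R4 by (simp add: power_mult_distrib)
          finally show ?thesis .
        qed
        have weq: "indicator {0<..<T} t * w z = r powr (- m) * E R"
          using t tT zin by (simp add: w_def r_def koranyi_powr mult_ac)
        \<comment> \<open>Factoring out one weight \<open>r^(-m)\<close> turns the powers of \<open>r\<close> in both terms into those of the single
          quantity \<open>Y = r^(-m) V Z\<close>.\<close>
        define Y where "Y = r powr (- m) * V * Z"
        have Y0: "0 \<le> Y" using Z0 by (simp add: Y_def V_def)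
        have r2: "r powr (- 2 * m) = r powr (- m) * r powr (- m)"
          by (simp add: powr_add[symmetric])
        have "\<bar>A\<bar> \<le> r powr (- m) * (Y * (K / R\<^sup>2))"
          using Ale unfolding r2 Y_def by (simp add: mult_ac)
        also have "\<dots> \<le> r powr (- m) * (c\<gamma> * R\<^sup>2 powr gam * Y powr p + E R)"
          unfolding E_def using young_weighted[OF p Y0 KR k0] by (intro mult_left_mono) auto
        also have "\<dots> = r powr (- (p + 1) * m) * V powr p * (c\<gamma> * R\<^sup>2 powr gam * Z powr p) + r powr (- m) * E R"
        proof -
          have "r powr (- (p + 1) * m) = r powr (- m) * r powr (- m * p)"
            by (simp add: powr_add[symmetric] algebra_simps)
          then show ?thesis
            using Z0 by (simp add: Y_def V_def powr_mult powr_powr algebra_simps)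
        qed
        also have "\<dots> \<le> B + indicator {0<..<T} t * w z"
          unfolding weq using Bge by simp
        finally show ?thesis .
      qed
      then show ?thesis
        unfolding A_def B_def V_def r_def by linarith
    qed
    define J where "J = (LINT t|lborel. indicator {0<..} t * t powr \<alpha> * a t)"
    have Ji: "integrable lborel (\<lambda>t. indicator {0<..} t * t powr \<alpha> * a t)"
      and Jge: "(1 / 2) ^ n * (T / 2) powr (\<alpha> + 1) / (\<alpha> + 1) \<le> J"
      unfolding J_def a_def using time_weight_integral[OF \<alpha> T, of n] n2 by auto
    have RT: "R\<^sup>2 powr x = R powr (2 * x)" for x
    proof -
      have "R\<^sup>2 = R powr 2" using R by simp
      then show ?thesis by (simp only: powr_powr)
    qed
    have "c * R powr (2 * (\<alpha> + 1)) = (1 / 2) ^ n * (T / 2) powr (\<alpha> + 1) / (\<alpha> + 1)"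
      using T unfolding c_def RT[symmetric] T_def[symmetric]
      by (simp add: powr_divide)
    with Jge have J1: "c * R powr (2 * (\<alpha> + 1)) \<le> J" by simp
    have "J * (LINT z|lebesgue. koranyi z powr (- m) * f z * b z)
         \<le> (LINT z|lebesgue. \<bar>koranyi z powr (- m) * u0 z\<bar>) + T * (E R * (Kw * (2 * R) powr (d - m)))"
      unfolding J_def
    proof (rule test_function_inequality[OF sol m(1) test _ _ b01 bm u0 f Ji wm w0 wI W0 T G])
      show "0 \<le> a t * b z" for t z
        using b01[of z] by (simp add: a_def)
      show "a 0 = 1" by (simp add: a_def pos_pow_def)
      show "(a has_real_derivative deriv a t) (at t)" for t
        unfolding deriv_a by (rule da)
    qed
    also have "T * (E R * (Kw * (2 * R) powr (d - m))) = KK * R powr (d + 2 - m - 2 * (p + gam) / (p - 1))"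
    proof -
      have "E R = K powr (p / (p - 1)) * c\<gamma> powr (- 1 / (p - 1))
          * (R powr (- (2 * (p / (p - 1)))) * R powr (2 * gam * (- 1 / (p - 1))))"
        unfolding E_def using K0 c\<gamma>(1) R
        by (simp add: powr_mult powr_divide RT powr_powr powr_minus_divide)
      also have "R powr (- (2 * (p / (p - 1)))) * R powr (2 * gam * (- 1 / (p - 1)))
          = R powr (- (2 * (p + gam) / (p - 1)))"
        by (simp add: powr_add[symmetric] add_divide_distrib diff_divide_distrib algebra_simps)
      finally have ER: "E R = K powr (p / (p - 1)) * c\<gamma> powr (- 1 / (p - 1)) * R powr (- (2 * (p + gam) / (p - 1)))" .
      have TR: "T = R powr 2" using R by (simp add: T_def)
      have "d + 2 - m - 2 * (p + gam) / (p - 1) = 2 + (- (2 * (p + gam) / (p - 1)) + (d - m))" by simp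
      then have "R powr (d + 2 - m - 2 * (p + gam) / (p - 1))
          = R powr 2 * (R powr (- (2 * (p + gam) / (p - 1))) * R powr (d - m))"
        by (simp only: powr_add)
      then show ?thesis
        unfolding ER TR KK_def using R by (simp add: powr_mult mult_ac)
    qed
    finally show ?thesis using J1 unfolding b_def by blast
  qed
  then show ?thesis
    using c0 unfolding d_def
    by (intro exI[of _ c] conjI exI[of _ KK]) (auto simp: algebra_simps)
qed

section \<open>Nonexistence of global solutions\<close>

lemma powr_growth_contradiction:
  fixes c K0 K1 x y :: real
  assumes "0 < c" "0 < x" "y < x"
    and le: "\<forall>\<^sub>F k in sequentially. c * real k powr x \<le> K0 + K1 * real k powr y"
  shows False
proof -
  have lim: "(\<lambda>k. real k powr - d) \<longlonglongrightarrow> 0" if "d > 0" for d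
    using that by (intro tendsto_neg_powr filterlim_real_sequentially) auto
  have "(\<lambda>k. K0 * real k powr (- x) + K1 * real k powr (- (x - y))) \<longlonglongrightarrow> K0 * 0 + K1 * 0"
    using assms by (intro tendsto_intros lim) auto
  then have "\<forall>\<^sub>F k in sequentially. K0 * real k powr (- x) + K1 * real k powr (- (x - y)) < c"
    using \<open>0 < c\<close> by (intro order_tendstoD) auto
  with le have "\<forall>\<^sub>F k in sequentially. False"
    using eventually_gt_at_top[of 0]
  proof eventually_elim
    case (elim k)
    have "c = c * real k powr x * real k powr (- x)"
      using elim by (simp add: powr_minus)
    also have "\<dots> \<le> (K0 + K1 * real k powr y) * real k powr (- x)"
      using elim by (intro mult_right_mono) auto
    also have "\<dots> = K0 * real k powr (- x) + K1 * real k powr (- (x - y))"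
      by (simp add: distrib_right mult.assoc powr_add[symmetric])
    finally show ?case using elim by simp
  qed
  then show False by simp
qed

theorem theorem1p1:
  fixes lam gam \<alpha> p Q m :: real
    and u0 f :: "'n::finite heis \<Rightarrow> real"
  assumes Q: "Q = hom_dim TYPE('n)"
    and m: "m = hardy_mu TYPE('n) lam"
    and lam: "0 < lam" "lam < ((Q - 2) / 2)\<^sup>2"
    and gam: "0 \<le> gam" "gam < 1"
    and \<alpha>: "-1 < \<alpha>" "\<alpha> < 0"
    and u0: "integrable lebesgue (\<lambda>z. koranyi z powr (- m) * u0 z)"
    and f: "integrable lebesgue (\<lambda>z. koranyi z powr (- m) * f z)"
    and f_pos: "0 < (LINT z|lebesgue. koranyi z powr (- m) * f z)"
    and p: "1 < p" "p < (Q + 2 * gam - m - 2 * \<alpha>) / (Q - 2 - m - 2 * \<alpha>)"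
  shows "\<not> (\<exists>u. global_weak_solution lam gam \<alpha> p f u0 u)"
proof
  assume "\<exists>u. global_weak_solution lam gam \<alpha> p f u0 u"
  then obtain u where sol: "global_weak_solution lam gam \<alpha> p f u0 u" by blast
  have Qn: "Q = 2 * real CARD('n) + 2" by (simp add: Q hom_dim_def)
  have m_pos: "0 < m" and m_lt: "m < real CARD('n)"
    using hardy_mu_bounds[where 'n='n, of lam] lam m Q by auto
  obtain h h' h'' C where h: "0 < C" "\<And>s. (h has_real_derivative h' s) (at s)"
      "\<And>s. (h' has_real_derivative h'' s) (at s)" "continuous_on UNIV h''"
      "\<And>s. 0 \<le> h s \<and> h s \<le> 1" "\<And>s. s \<le> 1 \<Longrightarrow> h s = 1 \<and> h' s = 0" "\<And>s. s \<ge> 2 \<Longrightarrow> h s = 0"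
      "\<And>s. \<bar>h' s\<bar> \<le> C * h s powr (1 / p)" "\<And>s. \<bar>h'' s\<bar> \<le> C * h s powr (1 / p)"
    using ex_smooth_cutoff[OF p(1)] by blast
  define F where "F = (\<lambda>R. LINT z|lebesgue. koranyi z powr (- m) * f z * h (koranyi4 z / R ^ 4))"
  define F0 where "F0 = (LINT z|lebesgue. koranyi z powr (- m) * f z)"
  define x where "x = 2 * (\<alpha> + 1)"
  define y where "y = 2 * real CARD('n) + 4 - m - 2 * (p + gam) / (p - 1)"
  define U where "U = (LINT z|lebesgue. \<bar>koranyi z powr (- m) * u0 z\<bar>)"
  have "\<exists>c>0. \<exists>K. \<forall>R>0. \<exists>J \<ge> c * R powr x. J * F R \<le> U + K * R powr y"
    unfolding F_def U_def x_def y_def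
    by (rule testing_estimate[OF sol m _ _ gam \<alpha>(1) p(1) u0 f h(2-5) _ h(7) h(1,8,9)])
       (use m_pos m_lt h(6) in auto)
  then obtain c K where c: "0 < c" and est: "\<And>R. 0 < R \<Longrightarrow> \<exists>J \<ge> c * R powr x. J * F R \<le> U + K * R powr y"
    by blast
  have hm: "(\<lambda>z::'n heis. h (koranyi4 z / R ^ 4)) \<in> borel_measurable lebesgue" for R
  proof -
    have "continuous_on UNIV h"
      by (intro continuous_at_imp_continuous_on ballI DERIV_isCont[OF h(2)])
    then have "h \<in> borel_measurable borel" by (rule borel_measurable_continuous_onI)
    then have "(\<lambda>z::'n heis. h (koranyi4 z / R ^ 4)) \<in> borel_measurable borel" by measurable
    then show ?thesis by (intro measurable_completion) simp
  qed
  have "(\<lambda>k. F (real k)) \<longlonglongrightarrow> F0"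
    unfolding F_def F0_def
  proof (rule integral_dominated_convergence)
    show "(\<lambda>z. koranyi z powr (- m) * f z) \<in> borel_measurable lebesgue"
      using f by (rule borel_measurable_integrable)
    show "(\<lambda>z. koranyi z powr (- m) * f z * h (koranyi4 z / real k ^ 4)) \<in> borel_measurable lebesgue" for k
      using borel_measurable_integrable[OF f] hm by (rule borel_measurable_times)
    show "integrable lebesgue (\<lambda>z. norm (koranyi z powr (- m) * f z))"
      by (rule integrable_norm[OF f])
    show "AE z in lebesgue. norm (koranyi z powr (- m) * f z * h (koranyi4 z / real k ^ 4))
        \<le> norm (koranyi z powr (- m) * f z)" for k
      using h(5) by (intro AE_I2) (simp add: abs_mult mult_left_le)
    show "AE z in lebesgue. (\<lambda>k. koranyi z powr (- m) * f z * h (koranyi4 z / real k ^ 4))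
        \<longlonglongrightarrow> koranyi z powr (- m) * f z"
    proof (rule AE_I2)
      fix z :: "'n heis"
      have "\<forall>\<^sub>F k in sequentially. koranyi4 z + 1 \<le> real k"
        using filterlim_real_sequentially by (simp add: filterlim_at_top)
      then have "\<forall>\<^sub>F k in sequentially. koranyi z powr (- m) * f z * h (koranyi4 z / real k ^ 4)
          = koranyi z powr (- m) * f z"
      proof eventually_elim
        case (elim k)
        have k1: "1 \<le> real k" using elim koranyi4_nonneg[of z] by linarith
        have "koranyi4 z \<le> real k ^ 1" using elim by simp
        also have "\<dots> \<le> real k ^ 4" using k1 by (intro power_increasing) auto
        finally have "koranyi4 z / real k ^ 4 \<le> 1" using k1 by simp
        then show ?case using h(6) by simp
      qed
      then show "(\<lambda>k. koranyi z powr (- m) * f z * h (koranyi4 z / real k ^ 4))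
        \<longlonglongrightarrow> koranyi z powr (- m) * f z"
        by (rule tendsto_eventually)
    qed
  qed
  then have Fk: "\<forall>\<^sub>F k in sequentially. F0 / 2 < F (real k)"
    using f_pos by (intro order_tendstoD) (auto simp: F0_def)
  have F0: "0 < F0" using f_pos by (simp add: F0_def)
  \<comment> \<open>The hypothesis on \<open>p\<close> is equivalent to \<open>y < x\<close>.\<close>
  have den: "0 < Q - 2 - m - 2 * \<alpha>" using m_lt \<alpha> Qn by simp
  then have "p * (Q - 2 - m - 2 * \<alpha>) < Q + 2 * gam - m - 2 * \<alpha>"
    using p(2) by (simp add: less_divide_eq)
  then have "(Q - m - 2 * \<alpha>) * (p - 1) < 2 * (p + gam)"
    by (simp add: algebra_simps)
  then have "Q - m - 2 * \<alpha> < 2 * (p + gam) / (p - 1)"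
    using p(1) by (simp add: less_divide_eq)
  then have yx: "y < x" by (simp add: x_def y_def Qn)
  have "\<forall>\<^sub>F k in sequentially. (c * (F0 / 2)) * real k powr x \<le> U + K * real k powr y"
    using Fk eventually_gt_at_top[of 0]
  proof eventually_elim
    case (elim k)
    then obtain J where J: "c * real k powr x \<le> J" "J * F (real k) \<le> U + K * real k powr y"
      using est[of "real k"] by auto
    have "c * real k powr x * (F0 / 2) \<le> J * F (real k)"
      using J(1) elim F0 c by (intro mult_mono) (auto intro: order_trans[OF _ J(1)])
    then show ?case using J(2) by (simp add: mult_ac)
  qed
  then show False
    using powr_growth_contradiction[of "c * (F0 / 2)" x y U K] c F0 yx \<alpha> by (simp add: x_def)
qed

end
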